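(* Let $p$ be a prime. For every $k\ge1$, every $\underline{s}=(s_1,\ldots,s_k)$ with integers $s_i\ge0$, and every $\underline{m}=(m_1,\ldots,m_k)$ with integers $0\le m_i<p$, one has $\sigma(\underline{s};\underline{m})\in\mathcal{F}_\sigma$.
   Context: $\mathbb{N}=\{1,2,3,\ldots\}$; $|\cdot|$ is the $p$-adic absolute value; $D(r)=\{|z|\le r\}$, and a power series $\sum a_kz^k$ over $\mathbb{Q}_p$ converges on $D(r)$ if $|a_k|r^k\to0$. A function $f:\mathbb{N}_{\ge n_0}\to\mathbb{Q}_p$ (for some $n_0$) is a power series function if for each $0\le i<p$ there is $p_i(x)\in\mathbb{Q}_p[[x]]$ converging on $D(r_i)$ for some $r_i>|p|$ such that $f(a)=p_i(a-i)$ for all $a\ge n_0$ with $p\mid(a-i)$. Such $f$ extends uniquely to a power series function on $\mathbb{Z}_{\ge0}$; two power series functions agreeing on the intersection of their domains are identified. $\mathcal{F}$ is the algebra of power series functions. For $\underline{s}=(s_1,\ldots,s_k)$ and $\underline{m}=(m_1,\ldots,m_k)$ as in the claim, $$\sigma(\underline{s};\underline{m})(n)=\sum\frac{1}{n_1^{s_1}\cdots n_k^{s_k}},$$ summed over $0<n_1<\cdots<n_k<n$ with $p\mid(n_i-m_i)$ for all $i$. Put $\sigma_p(\underline{s})=\sigma(\underline{s};(0,\ldots,0))$ and $\sigma_p(\emptyset)=1$. $\mathcal{F}_\sigma$ is the $\mathcal{F}$-module of functions generated by the $\sigma_p(\underline{s})$ with $\underline{s}\in\bigcup_{n\ge0}\mathbb{N}^{\times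 n}$. *)

theory Defs
  imports "HOL-Analysis.Analysis" "HOL-Number_Theory.Cong" "Berlekamp_Zassenhaus.Finite_Field"
begin

section \<open>The \<open>p\<close>-adic absolute value on the rationals\<close>

definition rat_pabs :: "nat \<Rightarrow> rat \<Rightarrow> real" where
  "rat_pabs p q = (if q = 0 then 0 else
     real p powi (int (multiplicity (int p) (snd (quotient_of q)))
                - int (multiplicity (int p) (fst (quotient_of q)))))"

lemma rat_pabs_0 [simp]: "rat_pabs p 0 = 0"
  by (simp add: rat_pabs_def)

lemma rat_pabs_1 [simp]: "rat_pabs p 1 = 1"
  by (simp add: rat_pabs_def)

lemma rat_pabs_nonneg [simp]: "rat_pabs p q \<ge> 0"
  by (simp add: rat_pabs_def)

lemma rat_cases_int:
  obtains a b where "(q::rat) = of_int a / of_int b" "b \<noteq> 0"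
  by (metis quotient_of_denom_pos quotient_of_div less_irrefl surj_pair)

context
  fixes p :: nat
  assumes p: "prime p"
begin

lemma prime_int_p: "prime_elem (int p)"
  using p by (simp add: prime_imp_prime_elem)

lemma real_p_gt_1: "real p > 1"
  using p prime_gt_1_nat by simp

lemma rat_pabs_of_int_divide:
  assumes "a \<noteq> 0" "b \<noteq> 0"
  shows "rat_pabs p (of_int a / of_int b) =
    real p powi (int (multiplicity (int p) b) - int (multiplicity (int p) a))"
proof -
  define q :: rat where "q = of_int a / of_int b"
  obtain c d where cd: "quotient_of q = (c, d)" by (cases "quotient_of q")
  have d: "d > 0" using cd quotient_of_denom_pos by blast
  have qcd: "q = of_int c / of_int d" using cd quotient_of_div by blast
  have q0: "q \<noteq> 0" using assms by (simp add: q_def)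
  then have c: "c \<noteq> 0" using qcd by auto
  have "(of_int (a * d) :: rat) = of_int (c * b)"
    using qcd q_def assms d by (simp add: field_simps)
  then have "a * d = c * b" by (simp only: of_int_eq_iff)
  then have "multiplicity (int p) (a * d) = multiplicity (int p) (c * b)" by simp
  then have "multiplicity (int p) a + multiplicity (int p) d
      = multiplicity (int p) c + multiplicity (int p) b"
    using assms c d by (simp add: prime_elem_multiplicity_mult_distrib[OF prime_int_p])
  then show ?thesis
    using q0 cd unfolding q_def[symmetric] rat_pabs_def
    by (auto intro!: arg_cong[where f = "\<lambda>k. real p powi k"])
qed

lemma rat_pabs_eq_0 [simp]: "rat_pabs p q = 0 \<longleftrightarrow> q = 0"
  using real_p_gt_1 by (simp add: rat_pabs_def)

lemma rat_pabs_mult: "rat_pabs p (x * y) = rat_pabs p x * rat_pabs p y"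
proof (cases "x = 0 \<or> y = 0")
  case False
  obtain a b where ab: "x = of_int a / of_int b" "b \<noteq> 0" by (rule rat_cases_int)
  obtain c d where cd: "y = of_int c / of_int d" "d \<noteq> 0" by (rule rat_cases_int)
  from False ab cd have ac: "a \<noteq> 0" "c \<noteq> 0" by auto
  have xy: "x * y = of_int (a * c) / of_int (b * d)" using ab cd by simp
  have "rat_pabs p (x * y) = real p powi
     (int (multiplicity (int p) (b * d)) - int (multiplicity (int p) (a * c)))"
    unfolding xy using ab cd ac by (intro rat_pabs_of_int_divide) auto
  also have "\<dots> = real p powi
     ((int (multiplicity (int p) b) - int (multiplicity (int p) a)) +
      (int (multiplicity (int p) d) - int (multiplicity (int p) c)))"
    using ab cd ac by (simp add: prime_elem_multiplicity_mult_distrib[OF prime_int_p] algebra_simps)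
  also have "\<dots> = rat_pabs p x * rat_pabs p y"
    using real_p_gt_1 ab cd ac by (subst power_int_add) (simp_all add: rat_pabs_of_int_divide)
  finally show ?thesis .
qed auto

lemma rat_pabs_minus [simp]: "rat_pabs p (- x) = rat_pabs p x"
proof -
  have "rat_pabs p (-1) * rat_pabs p (-1) = 1"
    by (simp flip: rat_pabs_mult)
  then have "rat_pabs p (-1) = 1"
    by (metis abs_of_nonneg mult_1 rat_pabs_nonneg abs_mult_self_eq real_sqrt_abs2 real_sqrt_one)
  then show ?thesis
    using rat_pabs_mult[of "-1" x] by simp
qed

lemma rat_pabs_inverse: "rat_pabs p (inverse x) = inverse (rat_pabs p x)"
proof (cases "x = 0")
  case False
  then have "rat_pabs p (inverse x) * rat_pabs p x = 1"
    by (simp flip: rat_pabs_mult)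
  then show ?thesis by (metis inverse_unique mult.commute)
qed simp

lemma rat_pabs_of_int_le_1: "rat_pabs p (of_int a) \<le> 1"
proof (cases "a = 0")
  case False
  then have "rat_pabs p (of_int a / of_int 1) =
      real p powi (int (multiplicity (int p) 1) - int (multiplicity (int p) a))"
    by (intro rat_pabs_of_int_divide) auto
  also have "\<dots> \<le> 1"
    using real_p_gt_1 by (simp add: power_int_minus field_simps)
  finally show ?thesis by simp
qed simp

lemma rat_pabs_add_le_1:
  assumes "rat_pabs p x \<le> 1"
  shows "rat_pabs p (1 + x) \<le> 1"
proof (cases "x = 0")
  case False
  obtain a b where cd: "quotient_of x = (a, b)" by (cases "quotient_of x")
  have b: "b > 0" using cd quotient_of_denom_pos by blast
  have x: "x = of_int a / of_int b" using cd quotient_of_div by blast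
  have a: "a \<noteq> 0" using x False by auto
  have cop: "coprime a b" using cd quotient_of_coprime by blast
  have "real p powi (int (multiplicity (int p) b) - int (multiplicity (int p) a)) \<le> real p powi 0"
    using assms a b by (simp add: x rat_pabs_of_int_divide)
  then have le: "multiplicity (int p) b \<le> multiplicity (int p) a"
    using power_int_strict_increasing[of 0 "int (multiplicity (int p) b) - int (multiplicity (int p) a)" "real p"]
      real_p_gt_1 by linarith
  have "multiplicity (int p) b = 0"
  proof (rule ccontr)
    assume "multiplicity (int p) b \<noteq> 0"
    then have "multiplicity (int p) b \<noteq> 0" "multiplicity (int p) a \<noteq> 0"
      using le by auto
    then have "int p dvd b" "int p dvd a"
      using not_dvd_imp_multiplicity_0[of "int p" b] not_dvd_imp_multiplicity_0[of "int p" a] by auto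
    with cop have "is_unit (int p)" using coprime_common_divisor by blast
    then show False using prime_int_p by (simp add: prime_elem_def)
  qed
  then have "rat_pabs p (of_int b / of_int 1) = 1"
    using b by (subst rat_pabs_of_int_divide) auto
  moreover have "1 + x = of_int (b + a) * inverse (of_int b)"
    using x b by (simp add: field_simps)
  ultimately show ?thesis
    using rat_pabs_of_int_le_1[of "b + a"] by (simp add: rat_pabs_mult rat_pabs_inverse del: of_int_add)
qed simp

lemma rat_pabs_add: "rat_pabs p (x + y) \<le> max (rat_pabs p x) (rat_pabs p y)"
proof -
  have *: "rat_pabs p (x + y) \<le> rat_pabs p x" if "rat_pabs p y \<le> rat_pabs p x" for x y
  proof (cases "x = 0")
    case False
    have "rat_pabs p (y / x) \<le> 1"
    proof -
      have "rat_pabs p x > 0" using False by (simp add: order_less_le)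
      moreover have "rat_pabs p (y / x) = rat_pabs p y / rat_pabs p x"
        by (simp add: divide_inverse rat_pabs_mult rat_pabs_inverse)
      ultimately show ?thesis using that by simp
    qed
    then have "rat_pabs p (1 + y / x) \<le> 1" by (rule rat_pabs_add_le_1)
    then have "rat_pabs p x * rat_pabs p (1 + y / x) \<le> rat_pabs p x"
      by (simp add: mult_left_le)
    moreover have "x + y = x * (1 + y / x)" using False by (simp add: field_simps)
    ultimately show ?thesis by (simp add: rat_pabs_mult)
  qed (use that in \<open>simp\<close>)
  show ?thesis
    using *[of x y] *[of y x] by (cases "rat_pabs p y \<le> rat_pabs p x") (auto simp: add.commute)
qed

lemma rat_pabs_triangle: "rat_pabs p (x + y) \<le> rat_pabs p x + rat_pabs p y"
  using rat_pabs_add[of x y] rat_pabs_nonneg[of p x] rat_pabs_nonneg[of p y] by linarith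

lemma rat_pabs_minus_commute: "rat_pabs p (x - y) = rat_pabs p (y - x)"
  by (metis minus_diff_eq rat_pabs_minus)

lemma rat_pabs_diff_le: "\<bar>rat_pabs p x - rat_pabs p y\<bar> \<le> rat_pabs p (x - y)"
  using rat_pabs_triangle[of "x - y" y] rat_pabs_triangle[of "y - x" x]
  by (simp add: rat_pabs_minus_commute)

lemma rat_pabs_p: "rat_pabs p (of_nat p) = 1 / real p"
proof -
  have "p \<noteq> 0" using p by auto
  then have "rat_pabs p (of_int (int p) / of_int 1) =
      real p powi (int (multiplicity (int p) 1) - int (multiplicity (int p) (int p)))"
    by (intro rat_pabs_of_int_divide) auto
  then show ?thesis
    using multiplicity_prime[OF prime_int_p] by (simp add: power_int_minus field_simps)
qed

end


section \<open>The field of \<open>p\<close>-adic numbers, as the completion of the rationals\<close>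

definition pcauchy :: "nat \<Rightarrow> (nat \<Rightarrow> rat) \<Rightarrow> bool" where
  "pcauchy p X \<longleftrightarrow> (\<forall>e>0. \<exists>N. \<forall>m\<ge>N. \<forall>n\<ge>N. rat_pabs p (X m - X n) < e)"

definition pvanishes :: "nat \<Rightarrow> (nat \<Rightarrow> rat) \<Rightarrow> bool" where
  "pvanishes p X \<longleftrightarrow> (\<lambda>n. rat_pabs p (X n)) \<longlonglongrightarrow> 0"

context
  fixes p :: nat
  assumes p: "prime p"
begin

lemma pcauchyD:
  assumes "pcauchy p X" "e > 0"
  obtains N where "\<And>m n. m \<ge> N \<Longrightarrow> n \<ge> N \<Longrightarrow> rat_pabs p (X m - X n) < e"
  using assms unfolding pcauchy_def by blast

lemma pcauchy_const [simp]: "pcauchy p (\<lambda>_. c)"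
  by (auto simp: pcauchy_def)

lemma pvanishes_const [simp]: "pvanishes p (\<lambda>_. c) \<longleftrightarrow> c = 0"
  using p by (simp add: pvanishes_def LIMSEQ_const_iff)

lemma pcauchy_add:
  assumes "pcauchy p X" "pcauchy p Y"
  shows "pcauchy p (\<lambda>n. X n + Y n)"
  unfolding pcauchy_def
proof (intro allI impI)
  fix e :: real assume "e > 0"
  obtain M where M: "\<And>m n. m \<ge> M \<Longrightarrow> n \<ge> M \<Longrightarrow> rat_pabs p (X m - X n) < e"
    using pcauchyD[OF assms(1) \<open>e > 0\<close>] by blast
  obtain N where N: "\<And>m n. m \<ge> N \<Longrightarrow> n \<ge> N \<Longrightarrow> rat_pabs p (Y m - Y n) < e"
    using pcauchyD[OF assms(2) \<open>e > 0\<close>] by blast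
  have "rat_pabs p (X m + Y m - (X n + Y n)) < e" if "m \<ge> max M N" "n \<ge> max M N" for m n
  proof -
    have "rat_pabs p ((X m - X n) + (Y m - Y n)) < e"
      using rat_pabs_add[OF p, of "X m - X n" "Y m - Y n"] M[of m n] N[of m n] that
      by simp
    then show ?thesis by (simp add: algebra_simps)
  qed
  then show "\<exists>N. \<forall>m\<ge>N. \<forall>n\<ge>N. rat_pabs p (X m + Y m - (X n + Y n)) < e" by blast
qed

lemma pcauchy_minus: "pcauchy p X \<Longrightarrow> pcauchy p (\<lambda>n. - X n)"
  using rat_pabs_minus_commute[OF p] by (simp add: pcauchy_def)

lemma pvanishes_add:
  assumes "pvanishes p X" "pvanishes p Y"
  shows "pvanishes p (\<lambda>n. X n + Y n)"
  unfolding pvanishes_def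
proof (rule tendsto_sandwich[OF _ _ tendsto_const])
  show "(\<lambda>n. rat_pabs p (X n) + rat_pabs p (Y n)) \<longlonglongrightarrow> 0"
    using tendsto_add[OF assms[unfolded pvanishes_def]] by simp
qed (use rat_pabs_triangle[OF p] in auto)

lemma pvanishes_minus: "pvanishes p (\<lambda>n. - X n) \<longleftrightarrow> pvanishes p X"
  using p by (simp add: pvanishes_def)

lemma pvanishes_diff_commute: "pvanishes p (\<lambda>n. X n - Y n) \<longleftrightarrow> pvanishes p (\<lambda>n. Y n - X n)"
  using pvanishes_minus[of "\<lambda>n. X n - Y n"] by simp

lemma pcauchy_pvanishes_or_const:
  assumes "pcauchy p X" "\<not> pvanishes p X"
  obtains c N where "c > 0" "\<And>n. n \<ge> N \<Longrightarrow> rat_pabs p (X n) = c"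
proof -
  obtain e where e: "e > 0" and ne: "\<And>N. \<exists>n\<ge>N. rat_pabs p (X n) \<ge> e"
    using assms(2) unfolding pvanishes_def LIMSEQ_iff by (force simp: not_less)
  obtain N where N: "\<And>m n. m \<ge> N \<Longrightarrow> n \<ge> N \<Longrightarrow> rat_pabs p (X m - X n) < e"
    using pcauchyD[OF assms(1) e] by blast
  obtain k where k: "k \<ge> N" "rat_pabs p (X k) \<ge> e" using ne by blast
  have *: "rat_pabs p (X n) = rat_pabs p (X k)" if "n \<ge> N" for n
    using rat_pabs_add[OF p, of "X n - X k" "X k"] rat_pabs_add[OF p, of "X k - X n" "X n"]
      N[of n k] N[of k n] k that by (auto simp: max_def split: if_splits)
  show thesis
    by (rule that[of "rat_pabs p (X k)" N]) (use e k in linarith, rule *)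
qed

lemma pcauchy_bounded:
  assumes "pcauchy p X"
  obtains B where "B > 0" "\<And>n. rat_pabs p (X n) \<le> B"
proof -
  have "Bseq (\<lambda>n. rat_pabs p (X n))"
  proof (cases "pvanishes p X")
    case True
    then show ?thesis
      unfolding pvanishes_def by (intro convergent_imp_Bseq) (auto simp: convergent_def)
  next
    case False
    then obtain c N where "c > 0" "\<And>n. n \<ge> N \<Longrightarrow> rat_pabs p (X n) = c"
      using pcauchy_pvanishes_or_const[OF assms] by metis
    then have "(\<lambda>n. rat_pabs p (X n)) \<longlonglongrightarrow> c"
      by (intro tendsto_eventually eventually_sequentiallyI)
    then show ?thesis
      by (intro convergent_imp_Bseq) (auto simp: convergent_def)
  qed
  then show thesis
    using that by (auto elim!: BseqE)
qed

lemma pvanishes_mult_bounded: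
  assumes "\<And>n. rat_pabs p (X n) \<le> B" "pvanishes p Y"
  shows "pvanishes p (\<lambda>n. X n * Y n)"
  unfolding pvanishes_def
proof (rule tendsto_sandwich[OF _ _ tendsto_const])
  show "(\<lambda>n. B * rat_pabs p (Y n)) \<longlonglongrightarrow> 0"
    using tendsto_mult_right_zero[OF assms(2)[unfolded pvanishes_def]] .
  show "\<forall>\<^sub>F n in sequentially. rat_pabs p (X n * Y n) \<le> B * rat_pabs p (Y n)"
    using assms(1) p by (simp add: rat_pabs_mult mult_right_mono)
qed auto

lemma pcauchy_mult:
  assumes "pcauchy p X" "pcauchy p Y"
  shows "pcauchy p (\<lambda>n. X n * Y n)"
  unfolding pcauchy_def
proof (intro allI impI)
  fix e :: real assume e: "e > 0"
  obtain A where A: "A > 0" "\<And>n. rat_pabs p (X n) \<le> A" using pcauchy_bounded[OF assms(1)] by blast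
  obtain B where B: "B > 0" "\<And>n. rat_pabs p (Y n) \<le> B" using pcauchy_bounded[OF assms(2)] by blast
  obtain M where M: "\<And>m n. m \<ge> M \<Longrightarrow> n \<ge> M \<Longrightarrow> rat_pabs p (X m - X n) < e / B"
    using pcauchyD[OF assms(1), of "e / B"] e B by (metis divide_pos_pos)
  obtain N where N: "\<And>m n. m \<ge> N \<Longrightarrow> n \<ge> N \<Longrightarrow> rat_pabs p (Y m - Y n) < e / A"
    using pcauchyD[OF assms(2), of "e / A"] e A by (metis divide_pos_pos)
  have "rat_pabs p (X m * Y m - X n * Y n) < e" if mn: "m \<ge> max M N" "n \<ge> max M N" for m n
  proof -
    have "rat_pabs p (X m) * rat_pabs p (Y m - Y n) \<le> A * rat_pabs p (Y m - Y n)"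
      using A by (intro mult_right_mono) auto
    also have "\<dots> < e" using N[of m n] mn A by (simp add: field_simps)
    finally have 1: "rat_pabs p (X m * (Y m - Y n)) < e" using p by (simp add: rat_pabs_mult)
    have "rat_pabs p (X m - X n) * rat_pabs p (Y n) \<le> rat_pabs p (X m - X n) * B"
      using B by (intro mult_left_mono) auto
    also have "\<dots> < e" using M[of m n] mn B by (simp add: field_simps)
    finally have 2: "rat_pabs p ((X m - X n) * Y n) < e" using p by (simp add: rat_pabs_mult)
    have "X m * Y m - X n * Y n = X m * (Y m - Y n) + (X m - X n) * Y n"
      by (simp add: algebra_simps)
    then show ?thesis
      using rat_pabs_add[OF p, of "X m * (Y m - Y n)" "(X m - X n) * Y n"] 1 2 by simp
  qed
  then show "\<exists>N. \<forall>m\<ge>N. \<forall>n\<ge>N. rat_pabs p (X m * Y m - X n * Y n) < e" by blast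
qed

lemma rat_pabs_inverse_diff:
  assumes "x \<noteq> 0" "y \<noteq> 0"
  shows "rat_pabs p (inverse x - inverse y) = rat_pabs p (x - y) / (rat_pabs p x * rat_pabs p y)"
proof -
  have "inverse x - inverse y = (y - x) * inverse x * inverse y"
    using assms by (simp add: field_simps)
  then have "rat_pabs p (inverse x - inverse y)
      = rat_pabs p (x - y) * inverse (rat_pabs p x) * inverse (rat_pabs p y)"
    by (simp only: rat_pabs_mult[OF p] rat_pabs_inverse[OF p] rat_pabs_minus_commute[OF p, of x y])
  then show ?thesis by (simp add: divide_inverse)
qed

lemma pcauchy_inverse:
  assumes "pcauchy p X" "\<not> pvanishes p X"
  shows "pcauchy p (\<lambda>n. inverse (X n))"
  unfolding pcauchy_def
proof (intro allI impI)
  fix e :: real assume e: "e > 0"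
  obtain c N where c: "c > 0" and N: "\<And>n. n \<ge> N \<Longrightarrow> rat_pabs p (X n) = c"
    using pcauchy_pvanishes_or_const[OF assms] by metis
  obtain M where M: "\<And>m n. m \<ge> M \<Longrightarrow> n \<ge> M \<Longrightarrow> rat_pabs p (X m - X n) < e * (c * c)"
    using pcauchyD[OF assms(1), of "e * (c * c)"] e c by (metis mult_pos_pos)
  have "rat_pabs p (inverse (X m) - inverse (X n)) < e" if "m \<ge> max M N" "n \<ge> max M N" for m n
  proof -
    have c': "rat_pabs p (X m) = c" "rat_pabs p (X n) = c" using N that by auto
    then have "X m \<noteq> 0" "X n \<noteq> 0" using c by auto
    then have "rat_pabs p (inverse (X m) - inverse (X n)) = rat_pabs p (X m - X n) / (c * c)"
      using c' by (simp add: rat_pabs_inverse_diff)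
    also have "\<dots> < e" using M[of m n] that c by (simp add: field_simps)
    finally show ?thesis .
  qed
  then show "\<exists>N. \<forall>m\<ge>N. \<forall>n\<ge>N. rat_pabs p (inverse (X m) - inverse (X n)) < e" by blast
qed

lemma pvanishes_cong_eventually:
  assumes "\<And>n. n \<ge> N \<Longrightarrow> X n = Y n"
  shows "pvanishes p X \<longleftrightarrow> pvanishes p Y"
  unfolding pvanishes_def
  by (intro tendsto_cong eventually_sequentiallyI[of N]) (use assms in auto)

lemma pvanishes_diff_inverse:
  assumes "pcauchy p X" "\<not> pvanishes p X" "pcauchy p Y" "\<not> pvanishes p Y"
    and "pvanishes p (\<lambda>n. X n - Y n)"
  shows "pvanishes p (\<lambda>n. inverse (X n) - inverse (Y n))"
proof -
  obtain c M where c: "c > 0" "\<And>n. n \<ge> M \<Longrightarrow> rat_pabs p (X n) = c"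
    using pcauchy_pvanishes_or_const[OF assms(1,2)] by metis
  obtain d N where d: "d > 0" "\<And>n. n \<ge> N \<Longrightarrow> rat_pabs p (Y n) = d"
    using pcauchy_pvanishes_or_const[OF assms(3,4)] by metis
  have ev: "\<forall>\<^sub>F n in sequentially.
      rat_pabs p (X n - Y n) / (c * d) = rat_pabs p (inverse (X n) - inverse (Y n))"
  proof (rule eventually_sequentiallyI[of "max M N"])
    fix n assume "n \<ge> max M N"
    then have *: "rat_pabs p (X n) = c" "rat_pabs p (Y n) = d" using c d by auto
    then have "X n \<noteq> 0" "Y n \<noteq> 0" using c(1) d(1) by auto
    with * show "rat_pabs p (X n - Y n) / (c * d) = rat_pabs p (inverse (X n) - inverse (Y n))"
      by (simp add: rat_pabs_inverse_diff)
  qed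
  have "(\<lambda>n. rat_pabs p (X n - Y n) / (c * d)) \<longlonglongrightarrow> 0"
    using tendsto_divide_zero[OF assms(5)[unfolded pvanishes_def], of "c * d"] .
  then show ?thesis
    unfolding pvanishes_def by (rule Lim_transform_eventually) (rule ev)
qed

lemma pcauchy_rat_pabs_convergent:
  assumes "pcauchy p X"
  shows "convergent (\<lambda>n. rat_pabs p (X n))"
proof (cases "pvanishes p X")
  case True
  then show ?thesis by (auto simp: pvanishes_def convergent_def)
next
  case False
  then obtain c N where "c > 0" "\<And>n. n \<ge> N \<Longrightarrow> rat_pabs p (X n) = c"
    using pcauchy_pvanishes_or_const[OF assms] by metis
  then have "(\<lambda>n. rat_pabs p (X n)) \<longlonglongrightarrow> c"
    by (intro tendsto_eventually eventually_sequentiallyI)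
  then show ?thesis by (auto simp: convergent_def)
qed

end

definition padic_rel :: "nat \<Rightarrow> (nat \<Rightarrow> rat) \<Rightarrow> (nat \<Rightarrow> rat) \<Rightarrow> bool" where
  "padic_rel p X Y \<longleftrightarrow> pcauchy p X \<and> pcauchy p Y \<and> pvanishes p (\<lambda>n. X n - Y n)"


text \<open>For a type \<open>'p\<close> of prime cardinality \<open>p\<close>, the type \<open>'p padic\<close> is the field of
  \<open>p\<close>-adic numbers: equivalence classes of \<open>p\<close>-adic Cauchy sequences of rationals.\<close>

typedef (overloaded) 'p padic =
  "{{Y. padic_rel CARD('p::prime_card) X Y} |X. pcauchy CARD('p) X}"
  using pcauchy_const[OF prime_card, of 0] by blast

definition Padic :: "(nat \<Rightarrow> rat) \<Rightarrow> 'p::prime_card padic" where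
  "Padic X = Abs_padic {Y. padic_rel CARD('p) X Y}"

definition rep_padic :: "'p::prime_card padic \<Rightarrow> nat \<Rightarrow> rat" where
  "rep_padic x = (SOME X. X \<in> Rep_padic x)"

lemma padic_rel_refl: "prime p \<Longrightarrow> pcauchy p X \<Longrightarrow> padic_rel p X X"
  by (simp add: padic_rel_def)

lemma padic_rel_sym: "prime p \<Longrightarrow> padic_rel p X Y \<Longrightarrow> padic_rel p Y X"
  using pvanishes_diff_commute[of p X Y] by (simp add: padic_rel_def)

lemma padic_rel_trans: "prime p \<Longrightarrow> padic_rel p X Y \<Longrightarrow> padic_rel p Y Z \<Longrightarrow> padic_rel p X Z"
  unfolding padic_rel_def using pvanishes_add[of p "\<lambda>n. X n - Y n" "\<lambda>n. Y n - Z n"] by simp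

lemma Padic_eq_iff:
  assumes "pcauchy CARD('p::prime_card) X" "pcauchy CARD('p) Y"
  shows "(Padic X :: 'p padic) = Padic Y \<longleftrightarrow> pvanishes CARD('p) (\<lambda>n. X n - Y n)"
proof -
  note p = prime_card[where 'a = 'p]
  have "(Padic X :: 'p padic) = Padic Y \<longleftrightarrow>
      {Z. padic_rel CARD('p) X Z} = {Z. padic_rel CARD('p) Y Z}"
    unfolding Padic_def using assms by (subst Abs_padic_inject) auto
  also have "\<dots> \<longleftrightarrow> padic_rel CARD('p) X Y"
  proof
    assume "{Z. padic_rel CARD('p) X Z} = {Z. padic_rel CARD('p) Y Z}"
    then show "padic_rel CARD('p) X Y" using padic_rel_refl[OF p assms(2)] by (simp add: set_eq_iff)
  next
    assume XY: "padic_rel CARD('p) X Y"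
    show "{Z. padic_rel CARD('p) X Z} = {Z. padic_rel CARD('p) Y Z}"
    proof (intro Collect_cong iffI)
      fix Z
      show "padic_rel CARD('p) Y Z" if "padic_rel CARD('p) X Z"
        by (rule padic_rel_trans[OF p padic_rel_sym[OF p XY] that])
      show "padic_rel CARD('p) X Z" if "padic_rel CARD('p) Y Z"
        by (rule padic_rel_trans[OF p XY that])
    qed
  qed
  finally show ?thesis using assms by (simp add: padic_rel_def)
qed

lemma
  shows pcauchy_rep_padic [simp]: "pcauchy CARD('p) (rep_padic x)"
    and Padic_rep_padic [simp]: "Padic (rep_padic x) = (x :: 'p::prime_card padic)"
proof -
  note p = prime_card[where 'a = 'p]
  obtain X where X: "pcauchy CARD('p) X" "Rep_padic x = {Y. padic_rel CARD('p) X Y}"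
    using Rep_padic[of x] by auto
  then have "x = Padic X" unfolding Padic_def by (metis Rep_padic_inverse)
  have "X \<in> Rep_padic x" using X padic_rel_refl[OF p] by auto
  then have "rep_padic x \<in> Rep_padic x" unfolding rep_padic_def by (rule someI[of "\<lambda>X. X \<in> Rep_padic x"])
  then have "padic_rel CARD('p) X (rep_padic x)" unfolding X(2) by simp
  then have r: "padic_rel CARD('p) (rep_padic x) X" by (rule padic_rel_sym[OF p])
  then show c: "pcauchy CARD('p) (rep_padic x)" by (simp add: padic_rel_def)
  have "Padic (rep_padic x) = (Padic X :: 'p padic)"
    using r by (subst Padic_eq_iff[OF c X(1)]) (simp add: padic_rel_def)
  with \<open>x = Padic X\<close> show "Padic (rep_padic x) = x" by simp
qed

lemma padic_cases [cases type: padic]: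
  obtains X where "x = (Padic X :: 'p::prime_card padic)" "pcauchy CARD('p) X"
  using that[of "rep_padic x"] by simp

lemma pvanishes_rep_Padic:
  assumes "pcauchy CARD('p::prime_card) X"
  shows "pvanishes CARD('p) (\<lambda>n. rep_padic (Padic X :: 'p padic) n - X n)"
  using Padic_eq_iff[OF pcauchy_rep_padic[of "Padic X :: 'p padic"] assms] by simp

instantiation padic :: (prime_card) field
begin

definition zero_padic :: "'a padic" where "0 = Padic (\<lambda>_. 0)"
definition one_padic :: "'a padic" where "1 = Padic (\<lambda>_. 1)"
definition plus_padic :: "'a padic \<Rightarrow> 'a padic \<Rightarrow> 'a padic" where
  "x + y = Padic (\<lambda>n. rep_padic x n + rep_padic y n)"
definition uminus_padic :: "'a padic \<Rightarrow> 'a padic" where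
  "- x = Padic (\<lambda>n. - rep_padic x n)"
definition minus_padic :: "'a padic \<Rightarrow> 'a padic \<Rightarrow> 'a padic" where
  "x - y = x + - (y :: 'a padic)"
definition times_padic :: "'a padic \<Rightarrow> 'a padic \<Rightarrow> 'a padic" where
  "x * y = Padic (\<lambda>n. rep_padic x n * rep_padic y n)"
definition inverse_padic :: "'a padic \<Rightarrow> 'a padic" where
  "inverse x = (if x = 0 then 0 else Padic (\<lambda>n. inverse (rep_padic x n)))"
definition divide_padic :: "'a padic \<Rightarrow> 'a padic \<Rightarrow> 'a padic" where
  "x div y = x * inverse (y :: 'a padic)"

lemma add_Padic:
  assumes "pcauchy CARD('a) X" "pcauchy CARD('a) Y"
  shows "Padic X + Padic Y = (Padic (\<lambda>n. X n + Y n) :: 'a padic)"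
  unfolding plus_padic_def using assms
    pvanishes_add[OF prime_card pvanishes_rep_Padic[OF assms(1)] pvanishes_rep_Padic[OF assms(2)]]
  by (subst Padic_eq_iff) (auto intro!: pcauchy_add prime_card simp: algebra_simps)

lemma minus_Padic:
  assumes "pcauchy CARD('a) X"
  shows "- Padic X = (Padic (\<lambda>n. - X n) :: 'a padic)"
proof -
  note p = prime_card[where 'a = 'a]
  let ?X = "rep_padic (Padic X :: 'a padic)"
  have "pvanishes CARD('a) (\<lambda>n. - (?X n - X n))"
    using pvanishes_rep_Padic[OF assms] by (rule iffD2[OF pvanishes_minus[OF p]])
  moreover have "- (?X n - X n) = - ?X n - - X n" for n by simp
  ultimately have "pvanishes CARD('a) (\<lambda>n. - ?X n - - X n)" by (simp only:)
  then show ?thesis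
    unfolding uminus_padic_def
    by (subst Padic_eq_iff[OF pcauchy_minus[OF p pcauchy_rep_padic] pcauchy_minus[OF p assms]])
qed

lemma mult_Padic:
  assumes X: "pcauchy CARD('a) X" and Y: "pcauchy CARD('a) Y"
  shows "Padic X * Padic Y = (Padic (\<lambda>n. X n * Y n) :: 'a padic)"
proof -
  note p = prime_card[where 'a = 'a]
  let ?X = "rep_padic (Padic X :: 'a padic)" and ?Y = "rep_padic (Padic Y :: 'a padic)"
  obtain A where A: "\<And>n. rat_pabs CARD('a) (?X n) \<le> A" using pcauchy_bounded[OF p] pcauchy_rep_padic by metis
  obtain B where B: "\<And>n. rat_pabs CARD('a) (Y n) \<le> B" using pcauchy_bounded[OF p Y] by metis
  have "pvanishes CARD('a) (\<lambda>n. ?X n * (?Y n - Y n) + Y n * (?X n - X n))"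
    using pvanishes_rep_Padic[OF X] pvanishes_rep_Padic[OF Y] A B
    by (intro pvanishes_add[OF p] pvanishes_mult_bounded[OF p])
  then show ?thesis
    unfolding times_padic_def using X Y
    by (subst Padic_eq_iff) (auto intro!: pcauchy_mult p simp: algebra_simps)
qed

lemma Padic_eq_0_iff:
  assumes "pcauchy CARD('a) X"
  shows "Padic X = (0 :: 'a padic) \<longleftrightarrow> pvanishes CARD('a) X"
  unfolding zero_padic_def using assms by (subst Padic_eq_iff) (auto simp: prime_card)

lemma inverse_Padic:
  assumes X: "pcauchy CARD('a) X" and "\<not> pvanishes CARD('a) X"
  shows "inverse (Padic X) = (Padic (\<lambda>n. inverse (X n)) :: 'a padic)"
proof -
  note p = prime_card[where 'a = 'a]
  let ?X = "rep_padic (Padic X :: 'a padic)"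
  have nz: "Padic X \<noteq> (0 :: 'a padic)" using assms by (simp add: Padic_eq_0_iff)
  then have nv: "\<not> pvanishes CARD('a) ?X"
    using Padic_eq_0_iff[OF pcauchy_rep_padic[of "Padic X :: 'a padic"]] by simp
  note X' = pcauchy_rep_padic[of "Padic X :: 'a padic"]
  have "Padic (\<lambda>n. inverse (?X n)) = (Padic (\<lambda>n. inverse (X n)) :: 'a padic)"
    unfolding Padic_eq_iff[OF pcauchy_inverse[OF p X' nv] pcauchy_inverse[OF p assms]]
    by (rule pvanishes_diff_inverse[OF p X' nv assms pvanishes_rep_Padic[OF X]])
  then show ?thesis using nz by (simp add: inverse_padic_def)
qed

instance
proof
  note p = prime_card[where 'a = 'a]
  note [simp] = pcauchy_add[OF p] pcauchy_mult[OF p] pcauchy_minus[OF p] pcauchy_const[OF p]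
  fix x y z :: "'a padic"
  obtain X where x: "x = Padic X" "pcauchy CARD('a) X" by (cases x)
  obtain Y where y: "y = Padic Y" "pcauchy CARD('a) Y" by (cases y)
  obtain Z where z: "z = Padic Z" "pcauchy CARD('a) Z" by (cases z)
  show "(x + y) + z = x + (y + z)" using x y z by (simp add: add_Padic add.assoc)
  show "x + y = y + x" using x y by (simp add: add_Padic add.commute)
  show "0 + x = x" using x by (simp add: zero_padic_def add_Padic)
  show "- x + x = 0" using x by (simp add: zero_padic_def add_Padic minus_Padic)
  show "x - y = x + - y" by (rule minus_padic_def)
  show "(x * y) * z = x * (y * z)" using x y z by (simp add: mult_Padic mult.assoc)
  show "x * y = y * x" using x y by (simp add: mult_Padic mult.commute)
  show "1 * x = x" using x by (simp add: one_padic_def mult_Padic)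
  show "(x + y) * z = x * z + y * z"
    using x y z by (simp add: add_Padic mult_Padic distrib_right)
  show "(0 :: 'a padic) \<noteq> 1"
    unfolding zero_padic_def one_padic_def by (subst Padic_eq_iff) (auto simp: p)
  show "inverse (0 :: 'a padic) = 0" by (simp add: inverse_padic_def)
  show "x div y = x * inverse y" by (rule divide_padic_def)
  show "inverse x * x = 1" if "x \<noteq> 0"
  proof -
    have nv: "\<not> pvanishes CARD('a) X" using that x by (simp add: Padic_eq_0_iff)
    obtain c N where c: "c > 0" "\<And>n. n \<ge> N \<Longrightarrow> rat_pabs CARD('a) (X n) = c"
      using pcauchy_pvanishes_or_const[OF p x(2) nv] by metis
    have "inverse (X n) * X n - 1 = 0" if "n \<ge> N" for n
      using c(1) c(2)[OF that] by (cases "X n = 0") auto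
    then have "pvanishes CARD('a) (\<lambda>n. inverse (X n) * X n - 1)"
      using pvanishes_cong_eventually[OF p, of N "\<lambda>n. inverse (X n) * X n - 1" "\<lambda>_. 0"] p by simp
    then show ?thesis
      unfolding x(1) inverse_Padic[OF x(2) nv] one_padic_def
      using pcauchy_inverse[OF p x(2) nv] x(2) by (simp add: mult_Padic Padic_eq_iff)
  qed
qed

end

lemma of_nat_padic: "of_nat n = (Padic (\<lambda>_. of_nat n) :: 'p::prime_card padic)"
  by (induction n) (simp_all add: zero_padic_def one_padic_def add_Padic pcauchy_const prime_card add.commute)

instance padic :: (prime_card) field_char_0
proof
  note p = prime_card[where 'a = 'a]
  show "inj (of_nat :: nat \<Rightarrow> 'a padic)"
    by (rule injI) (simp add: of_nat_padic Padic_eq_iff p)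
qed

lemma of_int_padic: "of_int n = (Padic (\<lambda>_. of_int n) :: 'p::prime_card padic)"
  by (cases n rule: int_cases2) (simp_all add: of_nat_padic minus_Padic pcauchy_const prime_card)

lemma of_rat_padic: "of_rat q = (Padic (\<lambda>_. q) :: 'p::prime_card padic)"
proof -
  note p = prime_card[where 'a = 'p]
  obtain a b where q: "q = of_int a / of_int b" "b \<noteq> 0" by (rule rat_cases_int)
  have "of_rat q = (of_int a * inverse (of_int b) :: 'p padic)"
    unfolding q(1) of_rat_divide of_rat_of_int_eq by (rule field_class.field_divide_inverse)
  also have "\<dots> = Padic (\<lambda>_. q)"
    using q by (simp add: of_int_padic inverse_Padic mult_Padic p divide_inverse)
  finally show ?thesis .
qed

definition padic_abs :: "'p::prime_card padic \<Rightarrow> real" where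
  "padic_abs x = lim (\<lambda>n. rat_pabs CARD('p) (rep_padic x n))"

lemma rat_pabs_tendsto_padic_abs:
  assumes X: "pcauchy CARD('p::prime_card) X"
  shows "(\<lambda>n. rat_pabs CARD('p) (X n)) \<longlonglongrightarrow> padic_abs (Padic X :: 'p padic)"
proof -
  note p = prime_card[where 'a = 'p]
  let ?X = "rep_padic (Padic X :: 'p padic)"
  have 1: "(\<lambda>n. rat_pabs CARD('p) (?X n)) \<longlonglongrightarrow> padic_abs (Padic X :: 'p padic)"
    unfolding padic_abs_def using pcauchy_rat_pabs_convergent[OF p pcauchy_rep_padic]
    by (simp add: convergent_LIMSEQ_iff)
  have "(\<lambda>n. rat_pabs CARD('p) (?X n - X n)) \<longlonglongrightarrow> 0"
    using pvanishes_rep_Padic[OF X] by (simp add: pvanishes_def)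
  then have "(\<lambda>n. rat_pabs CARD('p) (X n) - rat_pabs CARD('p) (?X n)) \<longlonglongrightarrow> 0"
    by (rule Lim_null_comparison[rotated])
       (simp add: rat_pabs_diff_le[OF p] rat_pabs_minus_commute[OF p, of "?X _" "X _"])
  from tendsto_add[OF this 1] show ?thesis by simp
qed

lemma padic_abs_unique:
  assumes "pcauchy CARD('p::prime_card) X" "(\<lambda>n. rat_pabs CARD('p) (X n)) \<longlonglongrightarrow> c"
  shows "padic_abs (Padic X :: 'p padic) = c"
  using rat_pabs_tendsto_padic_abs[OF assms(1)] assms(2) LIMSEQ_unique by blast

lemma padic_abs_nonneg: "padic_abs (x :: 'p::prime_card padic) \<ge> 0"
  using rat_pabs_tendsto_padic_abs[OF pcauchy_rep_padic[of x]]
  by (intro tendsto_lowerbound[where F = sequentially]) auto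

lemma padic_abs_0_iff: "padic_abs (x :: 'p::prime_card padic) = 0 \<longleftrightarrow> x = 0"
proof (cases x)
  case (1 X)
  show ?thesis
    using rat_pabs_tendsto_padic_abs[OF 1(2)] padic_abs_unique[OF 1(2), of 0] 1
    by (auto simp: Padic_eq_0_iff pvanishes_def)
qed

lemma padic_abs_mult: "padic_abs (x * y) = padic_abs x * padic_abs (y :: 'p::prime_card padic)"
proof -
  note p = prime_card[where 'a = 'p]
  obtain X where x: "x = Padic X" "pcauchy CARD('p) X" by (cases x)
  obtain Y where y: "y = Padic Y" "pcauchy CARD('p) Y" by (cases y)
  have "(\<lambda>n. rat_pabs CARD('p) (X n * Y n)) \<longlonglongrightarrow> padic_abs x * padic_abs y"
    unfolding rat_pabs_mult[OF p] x(1) y(1)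
    by (intro tendsto_mult rat_pabs_tendsto_padic_abs x y)
  then show ?thesis
    using x y padic_abs_unique[OF pcauchy_mult[OF p x(2) y(2)]] by (simp add: mult_Padic)
qed

lemma padic_abs_add: "padic_abs (x + y) \<le> max (padic_abs x) (padic_abs (y :: 'p::prime_card padic))"
proof -
  note p = prime_card[where 'a = 'p]
  obtain X where x: "x = Padic X" "pcauchy CARD('p) X" by (cases x)
  obtain Y where y: "y = Padic Y" "pcauchy CARD('p) Y" by (cases y)
  have "padic_abs (Padic (\<lambda>n. X n + Y n) :: 'p padic) \<le> max (padic_abs x) (padic_abs y)"
    unfolding x(1) y(1)
    using rat_pabs_add[OF p]
    by (intro tendsto_le[OF _ tendsto_max[OF rat_pabs_tendsto_padic_abs[OF x(2)]
            rat_pabs_tendsto_padic_abs[OF y(2)]] rat_pabs_tendsto_padic_abs[OF pcauchy_add[OF p x(2) y(2)]]])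
       auto
  then show ?thesis using x y by (simp add: add_Padic)
qed

lemma padic_abs_of_rat: "padic_abs (of_rat q :: 'p::prime_card padic) = rat_pabs CARD('p) q"
  unfolding of_rat_padic by (rule padic_abs_unique) (auto simp: pcauchy_const prime_card)

lemma padic_abs_minus: "padic_abs (- x) = padic_abs (x :: 'p::prime_card padic)"
proof -
  have "padic_abs (- 1 :: 'p padic) = padic_abs (of_rat (- 1) :: 'p padic)" by (simp add: of_rat_minus)
  also have "\<dots> = 1" unfolding padic_abs_of_rat using rat_pabs_minus[OF prime_card, of 1] by simp
  finally show ?thesis using padic_abs_mult[of "-1" x] by simp
qed

lemma padic_abs_triangle: "padic_abs (x + y) \<le> padic_abs x + padic_abs (y :: 'p::prime_card padic)"
  using padic_abs_add[of x y] padic_abs_nonneg[of x] padic_abs_nonneg[of y] by linarith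

instantiation padic :: (prime_card) metric_space
begin

definition dist_padic :: "'a padic \<Rightarrow> 'a padic \<Rightarrow> real" where
  "dist x y = padic_abs (x - y :: 'a padic)"
definition uniformity_padic :: "('a padic \<times> 'a padic) filter" where
  "uniformity = (INF e\<in>{0<..}. principal {(x, y :: 'a padic). dist x y < e})"
definition open_padic :: "'a padic set \<Rightarrow> bool" where
  "open U \<longleftrightarrow> (\<forall>x\<in>U. eventually (\<lambda>(x', y). x' = x \<longrightarrow> y \<in> (U :: 'a padic set)) uniformity)"

instance
proof
  fix x y z :: "'a padic"
  show "dist x y = 0 \<longleftrightarrow> x = y" by (simp add: dist_padic_def padic_abs_0_iff)
  have "padic_abs ((x - z) + - (y - z)) \<le> padic_abs (x - z) + padic_abs (- (y - z))"
    by (rule padic_abs_triangle)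
  then show "dist x y \<le> dist x z + dist y z"
    by (simp add: dist_padic_def padic_abs_minus[of "y - z", simplified])
qed (simp_all add: dist_padic_def uniformity_padic_def open_padic_def)

end

lemma padic_abs_prime: "padic_abs (of_nat CARD('p) :: 'p::prime_card padic) = 1 / real CARD('p)"
  using padic_abs_of_rat[of "of_nat CARD('p)", where 'p = 'p] rat_pabs_p[OF prime_card[where 'a = 'p]]
  by simp

lemma of_rat_tendsto_Padic:
  assumes "pcauchy CARD('p::prime_card) X"
  shows "(\<lambda>n. of_rat (X n)) \<longlonglongrightarrow> (Padic X :: 'p padic)"
proof (rule metric_LIMSEQ_I)
  note p = prime_card[where 'a = 'p]
  fix e :: real assume e: "e > 0"
  then obtain N where N: "\<And>m n. m \<ge> N \<Longrightarrow> n \<ge> N \<Longrightarrow> rat_pabs CARD('p) (X m - X n) < e / 2"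
    using pcauchyD[OF p assms, of "e / 2"] by (metis half_gt_zero)
  have "dist (of_rat (X m)) (Padic X :: 'p padic) < e" if m: "m \<ge> N" for m
  proof -
    have c: "pcauchy CARD('p) (\<lambda>n. X m + - X n)"
      by (intro pcauchy_add pcauchy_minus pcauchy_const assms p)
    have "dist (of_rat (X m)) (Padic X :: 'p padic) = padic_abs (Padic (\<lambda>n. X m + - X n) :: 'p padic)"
      using assms by (simp add: dist_padic_def of_rat_padic minus_padic_def minus_Padic add_Padic
          pcauchy_const pcauchy_minus p)
    also have "\<dots> \<le> e / 2"
      using N[OF m] by (intro tendsto_upperbound[OF rat_pabs_tendsto_padic_abs[OF c]]
          eventually_sequentiallyI[of N]) (auto intro: less_imp_le)
    finally show ?thesis using e by simp
  qed
  then show "\<exists>N. \<forall>n\<ge>N. dist (of_rat (X n)) (Padic X :: 'p padic) < e" by blast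
qed

lemma of_rat_dense_padic:
  assumes "e > 0"
  obtains q where "dist (x :: 'p::prime_card padic) (of_rat q) < e"
proof -
  obtain X where "x = Padic X" "pcauchy CARD('p) X" by (cases x)
  with assms that show thesis
    using metric_LIMSEQ_D[OF of_rat_tendsto_Padic, of X e] by (metis dist_commute order_refl)
qed

instance padic :: (prime_card) complete_space
proof
  fix X :: "nat \<Rightarrow> 'a padic" assume X: "Cauchy X"
  have "\<forall>n. \<exists>q. dist (X n) (of_rat q) < inverse (real (Suc n))"
    by (metis of_rat_dense_padic inverse_positive_iff_positive of_nat_0_less_iff zero_less_Suc)
  then obtain q where q: "\<And>n. dist (X n) (of_rat (q n)) < inverse (real (Suc n))" by metis
  have lim: "(\<lambda>n. dist (X n) (of_rat (q n))) \<longlonglongrightarrow> 0"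
    by (rule tendsto_sandwich[OF _ _ tendsto_const LIMSEQ_inverse_real_of_nat])
       (intro always_eventually allI zero_le_dist less_imp_le[OF q])+
  have "pcauchy CARD('a) q"
    unfolding pcauchy_def
  proof (intro allI impI)
    fix e :: real assume e: "e > 0"
    obtain M where M: "\<And>m n. m \<ge> M \<Longrightarrow> n \<ge> M \<Longrightarrow> dist (X m) (X n) < e / 3"
      using X e unfolding Cauchy_def by (metis zero_less_divide_iff zero_less_numeral)
    obtain N where N: "\<And>n. n \<ge> N \<Longrightarrow> dist (X n) (of_rat (q n)) < e / 3"
      using metric_LIMSEQ_D[OF lim, of "e / 3"] e by auto
    have "rat_pabs CARD('a) (q m - q n) < e" if "m \<ge> max M N" "n \<ge> max M N" for m n
    proof -
      have "rat_pabs CARD('a) (q m - q n) = dist (of_rat (q m) :: 'a padic) (of_rat (q n))"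
        by (simp add: dist_padic_def padic_abs_of_rat flip: of_rat_diff)
      also have "\<dots> < e"
        using M[of m n] N[of m] N[of n] that
          dist_triangle[of "of_rat (q m)" "of_rat (q n)" "X m"]
          dist_triangle[of "X m" "of_rat (q n)" "X n"]
        by (simp add: dist_commute)
      finally show ?thesis .
    qed
    then show "\<exists>N. \<forall>m\<ge>N. \<forall>n\<ge>N. rat_pabs CARD('a) (q m - q n) < e" by blast
  qed
  then have "(\<lambda>n. of_rat (q n)) \<longlonglongrightarrow> (Padic q :: 'a padic)"
    by (rule of_rat_tendsto_Padic)
  then have "(\<lambda>n. dist (of_rat (q n)) (Padic q :: 'a padic)) \<longlonglongrightarrow> 0"
    by (rule iffD1[OF tendsto_dist_iff])
  from tendsto_add[OF lim this]
  have "(\<lambda>n. dist (X n) (of_rat (q n)) + dist (of_rat (q n)) (Padic q :: 'a padic)) \<longlonglongrightarrow> 0" by simp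
  then have "(\<lambda>n. dist (X n) (Padic q)) \<longlonglongrightarrow> 0"
    by (rule tendsto_sandwich[OF _ _ tendsto_const, rotated 2])
       (intro always_eventually allI zero_le_dist dist_triangle)+
  then have "X \<longlonglongrightarrow> Padic q" by (rule iffD2[OF tendsto_dist_iff])
  then show "convergent X" by (auto simp: convergent_def)
qed


section \<open>Power series functions\<close>

definition converges_on_disc :: "(nat \<Rightarrow> 'p::prime_card padic) \<Rightarrow> real \<Rightarrow> bool" where
  "converges_on_disc c r \<longleftrightarrow> (\<lambda>k. padic_abs (c k) * r ^ k) \<longlonglongrightarrow> 0"

text \<open>A function on \<open>{n0..}\<close> is modelled by a total function whose values below \<open>n0\<close>
  are disregarded.\<close>

definition power_series_function_from :: "nat \<Rightarrow> (nat \<Rightarrow> 'p::prime_card padic) \<Rightarrow> bool" where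
  "power_series_function_from n0 f \<longleftrightarrow>
     (\<forall>i<CARD('p). \<exists>c r. r > padic_abs (of_nat CARD('p) :: 'p padic) \<and> converges_on_disc c r \<and>
        (\<forall>a\<ge>n0. [a = i] (mod CARD('p)) \<longrightarrow>
           (\<lambda>k. c k * (of_nat a - of_nat i) ^ k) sums f a))"

text \<open>Every power series function extends uniquely to all of \<open>nat\<close>, and functions agreeing on
  the intersection of their domains are identified, so the algebra is represented by the
  extensions.\<close>

definition power_series_functions :: "(nat \<Rightarrow> 'p::prime_card padic) set" where
  "power_series_functions = {f. power_series_function_from 0 f}"


section \<open>Multiple harmonic sums\<close>

definition harmonic_index :: "nat \<Rightarrow> nat list \<Rightarrow> nat \<Rightarrow> nat list set" where
  "harmonic_index p m n = {ns. length ns = length m \<and> sorted_wrt (<) ns \<and>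
     (\<forall>i<length m. 0 < ns ! i \<and> ns ! i < n \<and> [ns ! i = m ! i] (mod p))}"

definition mh_sum :: "nat list \<Rightarrow> nat list \<Rightarrow> nat \<Rightarrow> 'p::prime_card padic" where
  "mh_sum s m n = (\<Sum>ns\<in>harmonic_index CARD('p) m n.
     1 / (\<Prod>i<length s. of_nat (ns ! i) ^ (s ! i)))"

definition mh_sum_p :: "nat list \<Rightarrow> nat \<Rightarrow> 'p::prime_card padic" where
  "mh_sum_p s = mh_sum s (replicate (length s) 0)"

lemma finite_harmonic_index: "finite (harmonic_index p m n)"
proof (rule finite_subset)
  show "harmonic_index p m n \<subseteq> {ns. set ns \<subseteq> {..<n} \<and> length ns = length m}"
    by (auto simp: harmonic_index_def in_set_conv_nth)
qed (simp add: finite_lists_length_eq)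

lemma mh_sum_p_Nil: "mh_sum_p [] n = 1"
proof -
  have "{ns :: nat list. ns = [] \<and> sorted_wrt (<) ns} = {[]}" by auto
  then show ?thesis by (simp add: mh_sum_p_def mh_sum_def harmonic_index_def)
qed

text \<open>The module of functions on the positive integers generated by the sums \<open>mh_sum_p s\<close> with
  positive exponents; the value at the argument \<open>0\<close> is disregarded.\<close>

definition mh_sum_module :: "(nat \<Rightarrow> 'p::prime_card padic) set" where
  "mh_sum_module = {g. \<exists>S f. finite S \<and> (\<forall>t\<in>S. (\<forall>x\<in>set t. 0 < x) \<and> f t \<in> power_series_functions) \<and>
     (\<forall>n\<ge>1. g n = (\<Sum>t\<in>S. f t n * mh_sum_p t n))}"

end

theory Submission
  imports Defs
begin

text \<open>
  A multiple harmonic sum is an iterated sum: the outermost variable \<open>j\<close> runs through a residue class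
  modulo \<open>p\<close>, and the summand is \<open>1 / j ^ s\<close> times a shorter multiple harmonic sum evaluated at \<open>j\<close>.
  By induction on the depth it therefore suffices that the operators
  \<open>g \<mapsto> (n \<mapsto> \<Sum>j. g j / j ^ s)\<close>, with \<open>0 < j < n\<close> and \<open>j \<equiv> m (mod p)\<close>, preserve the module
  (\<open>class_sum_module\<close>), and by linearity only \<open>g = f * mh_sum_p t\<close> with \<open>f\<close> a power series function
  has to be treated.

  The denominator is absorbed into \<open>f\<close>, one factor \<open>j\<close> at a time. On a class \<open>m \<noteq> 0\<close> the integer \<open>j\<close> is a
  \<open>p\<close>-adic unit and \<open>f j / j\<close> is again a power series in \<open>j - m\<close>. On the class \<open>0\<close> one has
  \<open>f j = c + j * h j\<close>: the constant produces the generator \<open>mh_sum_p (t @ [s])\<close>, which has positive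
  exponents, and \<open>h\<close> continues with \<open>s - 1\<close>.

  When no denominator is left, let \<open>H\<close> be an antidifference of \<open>f\<close> restricted to the class of \<open>m\<close>.
  For empty \<open>t\<close> the sum is \<open>H n - H 1\<close>. Otherwise summation by parts turns it into
  \<open>H n * mh_sum_p (t @ [a]) n\<close> minus a sum over the class \<open>0\<close> of \<open>H (l + 1) * mh_sum_p t l / l ^ a\<close>,
  which has smaller depth. This works because \<open>H\<close> is itself a power series function, and that is where
  convergence on a disc of radius strictly larger than the absolute value of \<open>p\<close> enters: in the variable
  \<open>x\<close> with \<open>j = m + p x\<close> the coefficients decay geometrically, while the polynomial
  \<open>\<Sum>y<x. y ^ k\<close> has coefficients of absolute value at most \<open>k + 1\<close> (\<open>power_sum_poly\<close>). A linear factor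
  is harmless against geometric decay (\<open>overconvergent_sum\<close>).
\<close>

section \<open>Absolute values, limits and series of p-adic numbers\<close>

lemma padic_abs_of_int_le_1: "padic_abs (of_int n :: 'p::prime_card padic) \<le> 1"
  using padic_abs_of_rat[of "of_int n", where 'p = 'p] rat_pabs_of_int_le_1[OF prime_card[where 'a = 'p]]
  by simp

lemma padic_abs_of_nat_le_1: "padic_abs (of_nat n :: 'p::prime_card padic) \<le> 1"
  using padic_abs_of_int_le_1[of "int n", where 'p = 'p] by simp

lemma padic_abs_1 [simp]: "padic_abs (1 :: 'p::prime_card padic) = 1"
  using padic_abs_of_rat[of 1, where 'p = 'p] by simp

lemma padic_abs_0 [simp]: "padic_abs (0 :: 'p::prime_card padic) = 0"
  by (simp add: padic_abs_0_iff)

lemma padic_abs_power: "padic_abs (x ^ n) = padic_abs (x :: 'p::prime_card padic) ^ n"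
  by (induction n) (simp_all add: padic_abs_mult)

lemma padic_abs_divide: "padic_abs (x / y) = padic_abs x / padic_abs (y :: 'p::prime_card padic)"
proof (cases "y = 0")
  case False
  then have "padic_abs (x / y) * padic_abs y = padic_abs x"
    by (simp flip: padic_abs_mult)
  then show ?thesis using False padic_abs_0_iff[of y] by (simp add: field_simps)
qed simp

lemma padic_abs_diff: "padic_abs (x - y) \<le> max (padic_abs x) (padic_abs (y :: 'p::prime_card padic))"
  using padic_abs_add[of x "- y"] by (simp add: padic_abs_minus)

lemma padic_abs_sum_le:
  fixes f :: "'i \<Rightarrow> 'p::prime_card padic"
  assumes "\<And>i. i \<in> A \<Longrightarrow> padic_abs (f i) \<le> B" and "0 \<le> B"
  shows "padic_abs (sum f A) \<le> B"
  using assms(1)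
proof (induction A rule: infinite_finite_induct)
  case (insert x F)
  then show ?case using padic_abs_add[of "f x" "sum f F"] by fastforce
qed (use assms(2) in simp_all)

lemma padic_abs_of_nat_unit:
  assumes "\<not> CARD('p) dvd n"
  shows "padic_abs (of_nat n :: 'p::prime_card padic) = 1"
proof -
  note p = prime_card[where 'a = 'p]
  have n: "n \<noteq> 0" using assms by (intro notI) simp
  have "\<not> int CARD('p) dvd int n" using assms by (simp only: int_dvd_int_iff not_False_eq_True)
  then have "multiplicity (int CARD('p)) (int n) = 0" by (rule not_dvd_imp_multiplicity_0)
  then have "rat_pabs CARD('p) (of_int (int n) / of_int 1) = 1"
    using n by (subst rat_pabs_of_int_divide[OF p]) simp_all
  then show ?thesis using padic_abs_of_rat[of "of_nat n", where 'p = 'p] by simp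
qed

lemma tendsto_padic_iff:
  "(f \<longlongrightarrow> l) F \<longleftrightarrow> ((\<lambda>x. padic_abs (f x - (l :: 'p::prime_card padic))) \<longlongrightarrow> 0) F"
  by (subst tendsto_dist_iff) (simp add: dist_padic_def)

lemma tendsto_padic_add:
  fixes f g :: "'b \<Rightarrow> 'p::prime_card padic"
  assumes "(f \<longlongrightarrow> a) F" "(g \<longlongrightarrow> b) F"
  shows "((\<lambda>x. f x + g x) \<longlongrightarrow> a + b) F"
  unfolding tendsto_padic_iff[where f = "\<lambda>x. f x + g x"]
proof (rule tendsto_sandwich[OF _ _ tendsto_const])
  show "((\<lambda>x. padic_abs (f x - a) + padic_abs (g x - b)) \<longlongrightarrow> 0) F"
    using tendsto_add[OF assms[unfolded tendsto_padic_iff]] by simp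
  show "\<forall>\<^sub>F x in F. padic_abs (f x + g x - (a + b)) \<le> padic_abs (f x - a) + padic_abs (g x - b)"
    using padic_abs_triangle[of "f _ - a" "g _ - b"] by (intro always_eventually) (simp add: add_diff_add)
qed (simp add: padic_abs_nonneg)

lemma tendsto_padic_mult:
  fixes f g :: "'b \<Rightarrow> 'p::prime_card padic"
  assumes "(f \<longlongrightarrow> a) F" "(g \<longlongrightarrow> b) F"
  shows "((\<lambda>x. f x * g x) \<longlongrightarrow> a * b) F"
  unfolding tendsto_padic_iff[where f = "\<lambda>x. f x * g x"]
proof (rule tendsto_sandwich[OF _ _ tendsto_const])
  let ?d = "\<lambda>x. padic_abs (f x - a) * padic_abs (g x - b)
    + (padic_abs a * padic_abs (g x - b) + padic_abs (f x - a) * padic_abs b)"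
  have "(?d \<longlongrightarrow> 0 * 0 + (padic_abs a * 0 + 0 * padic_abs b)) F"
    by (intro tendsto_intros assms[unfolded tendsto_padic_iff])
  then show "(?d \<longlongrightarrow> 0) F" by simp
  have "padic_abs (f x * g x - a * b) \<le> ?d x" for x
  proof -
    have "f x * g x - a * b = (f x - a) * (g x - b) + (a * (g x - b) + (f x - a) * b)"
      by (simp add: algebra_simps)
    then show ?thesis
      using padic_abs_triangle[of "(f x - a) * (g x - b)" "a * (g x - b) + (f x - a) * b"]
        padic_abs_triangle[of "a * (g x - b)" "(f x - a) * b"]
      by (simp add: padic_abs_mult)
  qed
  then show "\<forall>\<^sub>F x in F. padic_abs (f x * g x - a * b) \<le> ?d x" by simp
qed (simp add: padic_abs_nonneg)

instance padic :: (prime_card) topological_ab_group_add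
proof
  fix a b :: "'a padic"
  show "((\<lambda>x. fst x + snd x) \<longlongrightarrow> a + b) (nhds a \<times>\<^sub>F nhds b)"
    by (intro tendsto_padic_add filterlim_fst filterlim_snd)
  show "(uminus \<longlongrightarrow> - a) (nhds a)"
    using tendsto_padic_mult[OF tendsto_const[of "-1 :: 'a padic"] filterlim_ident[of "nhds a"]] by simp
qed

instance padic :: (prime_card) topological_semigroup_mult
proof
  fix a b :: "'a padic"
  show "((\<lambda>x. fst x * snd x) \<longlongrightarrow> a * b) (nhds a \<times>\<^sub>F nhds b)"
    by (intro tendsto_padic_mult filterlim_fst filterlim_snd)
qed

lemma sums_padic_cmult:
  assumes "f sums (s :: 'p::prime_card padic)"
  shows "(\<lambda>k. c * f k) sums (c * s)"
  using tendsto_mult_left[OF assms[unfolded sums_def], of c]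
  by (simp add: sums_def sum_distrib_left)

text \<open>In an ultrametric field a tail is no larger than its largest term, so the error after \<open>N\<close> terms obeys
  the same bound as the \<open>N\<close>-th term, with no factor \<open>1 / (1 - \<rho>)\<close>.\<close>

lemma geometric_padic_series:
  fixes u :: "nat \<Rightarrow> 'p::prime_card padic"
  assumes u: "\<And>k. padic_abs (u k) \<le> C * \<rho> ^ k" and \<rho>: "0 < \<rho>" "\<rho> < 1"
  shows "summable u" and "padic_abs (suminf u - (\<Sum>k<N. u k)) \<le> C * \<rho> ^ N"
proof -
  have "0 \<le> C" using u[of 0] padic_abs_nonneg[of "u 0"] by simp
  have tail: "padic_abs ((\<Sum>k<M. u k) - (\<Sum>k<N. u k)) \<le> C * \<rho> ^ N" if "N \<le> M" for M N
  proof -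
    have "(\<Sum>k<M. u k) - (\<Sum>k<N. u k) = (\<Sum>k\<in>{N..<M}. u k)"
      using that sum_diff_nat_ivl[of 0 N M u] by (simp add: lessThan_atLeast0)
    also have "padic_abs \<dots> \<le> C * \<rho> ^ N"
    proof (rule padic_abs_sum_le)
      fix k assume "k \<in> {N..<M}"
      then have "C * \<rho> ^ k \<le> C * \<rho> ^ N"
        using \<rho> \<open>0 \<le> C\<close> by (intro mult_left_mono power_decreasing) auto
      then show "padic_abs (u k) \<le> C * \<rho> ^ N" using u[of k] by simp
    qed (use \<rho> \<open>0 \<le> C\<close> in simp)
    finally show ?thesis .
  qed
  have lim: "(\<lambda>N. C * \<rho> ^ N) \<longlonglongrightarrow> 0"
    using \<rho> by (intro tendsto_mult_right_zero LIMSEQ_realpow_zero) auto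
  have "Cauchy (\<lambda>N. \<Sum>k<N. u k)"
  proof (rule metric_CauchyI)
    fix e :: real assume "e > 0"
    then obtain N where N: "C * \<rho> ^ N < e"
      using order_tendstoD(2)[OF lim] by (meson eventually_sequentially order_refl)
    have "dist (\<Sum>k<m. u k) (\<Sum>k<n. u k) < e" if "m \<ge> N" "n \<ge> N" for m n
    proof -
      have "padic_abs (((\<Sum>k<m. u k) - (\<Sum>k<N. u k)) - ((\<Sum>k<n. u k) - (\<Sum>k<N. u k))) < e"
        using padic_abs_diff[of "(\<Sum>k<m. u k) - (\<Sum>k<N. u k)" "(\<Sum>k<n. u k) - (\<Sum>k<N. u k)"]
          tail[OF that(1)] tail[OF that(2)] N by simp
      then show ?thesis by (simp add: dist_padic_def)
    qed
    then show "\<exists>M. \<forall>m\<ge>M. \<forall>n\<ge>M. dist (\<Sum>k<m. u k) (\<Sum>k<n. u k) < e" by blast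
  qed
  then show sm: "summable u" by (simp add: summable_iff_convergent Cauchy_convergent)
  have "(\<lambda>M. dist (\<Sum>k<M. u k) (\<Sum>k<N. u k)) \<longlonglongrightarrow> dist (suminf u) (\<Sum>k<N. u k)"
    by (intro tendsto_intros summable_LIMSEQ sm)
  then have "dist (suminf u) (\<Sum>k<N. u k) \<le> C * \<rho> ^ N"
    by (rule tendsto_upperbound)
       (use tail in \<open>auto intro!: eventually_sequentiallyI[of N] simp: dist_padic_def\<close>)
  then show "padic_abs (suminf u - (\<Sum>k<N. u k)) \<le> C * \<rho> ^ N" by (simp add: dist_padic_def)
qed

section \<open>Sums of powers\<close>

text \<open>Falling factorials are summed by an explicit formula, and their coefficients are integers; the bound
  on the coefficients of power sums rests on these two properties.\<close>

definition falling_factorial_poly :: "nat \<Rightarrow> 'a::comm_ring_1 poly" where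
  "falling_factorial_poly j = (\<Prod>i<j. [:- of_nat i, 1:])"

lemma falling_factorial_poly_Suc:
  "falling_factorial_poly (Suc j) = falling_factorial_poly j * [:- of_nat j, 1:]"
  by (simp add: falling_factorial_poly_def)

lemma degree_falling_factorial_poly_le: "degree (falling_factorial_poly j :: 'a::comm_ring_1 poly) \<le> j"
proof (induction j)
  case (Suc j)
  have "degree (falling_factorial_poly (Suc j) :: 'a poly) \<le> degree (falling_factorial_poly j :: 'a poly) + 1"
    unfolding falling_factorial_poly_Suc
    by (rule order.trans[OF degree_mult_le]) simp
  with Suc show ?case by simp
qed (simp add: falling_factorial_poly_def)

lemma padic_abs_coeff_falling_factorial_poly_le:
  "padic_abs (poly.coeff (falling_factorial_poly j :: 'p::prime_card padic poly) i) \<le> 1"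
proof (induction j arbitrary: i)
  case (Suc j)
  let ?q = "falling_factorial_poly j :: 'p padic poly"
  have "padic_abs (poly.coeff (pCons 0 ?q) i - of_nat j * poly.coeff ?q i) \<le> 1"
  proof (rule order.trans[OF padic_abs_diff], rule max.boundedI)
    show "padic_abs (poly.coeff (pCons 0 ?q) i) \<le> 1" using Suc by (cases i) simp_all
    show "padic_abs (of_nat j * poly.coeff ?q i) \<le> 1"
      unfolding padic_abs_mult using Suc padic_abs_of_nat_le_1 padic_abs_nonneg by (intro mult_le_one)
  qed
  then show ?case by (simp add: falling_factorial_poly_Suc mult.commute[of ?q])
qed (simp add: falling_factorial_poly_def coeff_1)

lemma sum_falling_factorial:
  "of_nat (Suc j) * (\<Sum>y<x. poly (falling_factorial_poly j) (of_nat y))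
     = (poly (falling_factorial_poly (Suc j)) (of_nat x) :: 'a::comm_ring_1)"
proof -
  have step: "poly (falling_factorial_poly (Suc j)) (z + 1)
      = (z + 1) * (poly (falling_factorial_poly j) z :: 'a)" for z
    unfolding falling_factorial_poly_def poly_prod
    by (subst prod.lessThan_Suc_shift) (simp add: algebra_simps)
  show ?thesis
  proof (induction x)
    case 0
    show ?case
      by (simp add: falling_factorial_poly_def poly_prod prod.lessThan_Suc_shift del: prod.lessThan_Suc)
  next
    case (Suc x)
    then show ?case
      using step[of "of_nat x"]
      by (simp add: falling_factorial_poly_Suc algebra_simps del: of_nat_Suc)
         (simp add: algebra_simps)
  qed
qed

text \<open>The coefficients \<open>a j\<close> are the Stirling numbers of the second kind; their being integers is what controls the denominators of power sums.
  The recursion comes from \<open>x * (x)\<^sub>j = (x)\<^sub>j\<^sub>+\<^sub>1 + j * (x)\<^sub>j\<close>, where \<open>(x)\<^sub>j\<close> is the falling factorial.\<close>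

lemma power_as_falling_factorials:
  "\<exists>a :: nat \<Rightarrow> int. \<forall>x :: 'a::comm_ring_1.
     x ^ k = (\<Sum>j\<le>k. of_int (a j) * poly (falling_factorial_poly j) x)"
proof (induction k)
  case 0
  show ?case by (intro exI[of _ "\<lambda>_. 1"]) (simp add: falling_factorial_poly_def)
next
  case (Suc k)
  then obtain a :: "nat \<Rightarrow> int"
    where a: "\<And>x :: 'a. x ^ k = (\<Sum>j\<le>k. of_int (a j) * poly (falling_factorial_poly j) x)" by blast
  define b where "b j = (if j = 0 then 0 else a (j - 1)) + (if j \<le> k then int j * a j else 0)" for j
  have "x ^ Suc k = (\<Sum>j\<le>Suc k. of_int (b j) * poly (falling_factorial_poly j) x)" for x :: 'a
  proof -
    have "x ^ Suc k = (\<Sum>j\<le>k. of_int (a j) * (x * poly (falling_factorial_poly j) x))"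
      by (simp add: a sum_distrib_left mult_ac)
    also have "\<dots> = (\<Sum>j\<le>k. of_int (a j) * poly (falling_factorial_poly (Suc j)) x)
        + (\<Sum>j\<le>k. of_int (int j * a j) * poly (falling_factorial_poly j) x)"
      unfolding sum.distrib[symmetric]
      by (intro sum.cong refl) (simp add: falling_factorial_poly_Suc algebra_simps)
    also have "(\<Sum>j\<le>k. of_int (a j) * poly (falling_factorial_poly (Suc j)) x)
        = (\<Sum>j\<le>Suc k. of_int (if j = 0 then 0 else a (j - 1)) * poly (falling_factorial_poly j) x)"
      by (subst sum.atMost_Suc_shift) simp
    also have "(\<Sum>j\<le>k. of_int (int j * a j) * poly (falling_factorial_poly j) x)
        = (\<Sum>j\<le>Suc k. of_int (if j \<le> k then int j * a j else 0) * poly (falling_factorial_poly j) x)"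
      by simp
    finally show ?thesis
      unfolding b_def of_int_add distrib_right sum.distrib .
  qed
  then show ?case by blast
qed

text \<open>The power of \<open>p\<close> dividing \<open>n\<close> is at most \<open>n\<close>, so dividing by \<open>n\<close> increases the absolute value
  by a factor of at most \<open>n\<close>.\<close>

lemma one_le_padic_abs_of_nat:
  assumes "n > 0"
  shows "1 \<le> real n * padic_abs (of_nat n :: 'p::prime_card padic)"
proof -
  note p = prime_card[where 'a = 'p]
  let ?v = "multiplicity (int CARD('p)) (int n)"
  have "int CARD('p) ^ ?v \<le> int n"
    using assms by (intro zdvd_imp_le multiplicity_dvd) auto
  then have "real_of_int (int CARD('p) ^ ?v) \<le> real_of_int (int n)" by (simp only: of_int_le_iff)
  then have le: "real CARD('p) ^ ?v \<le> real n" by simp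
  have "rat_pabs CARD('p) (of_int (int n) / of_int 1) = 1 / real CARD('p) ^ ?v"
    using assms by (subst rat_pabs_of_int_divide[OF p]) (simp_all add: power_int_minus divide_inverse)
  then have "padic_abs (of_nat n :: 'p padic) = 1 / real CARD('p) ^ ?v"
    using padic_abs_of_rat[of "of_nat n", where 'p = 'p] by simp
  then have "1 = real CARD('p) ^ ?v * padic_abs (of_nat n :: 'p padic)" by simp
  also have "\<dots> \<le> real n * padic_abs (of_nat n :: 'p padic)"
    by (rule mult_right_mono[OF le padic_abs_nonneg])
  finally show ?thesis .
qed

text \<open>Expanding \<open>y ^ k\<close> in falling factorials and summing each of them introduces only the denominators
  \<open>j + 1 \<le> k + 1\<close>. Estimating the usual recursion for power sums term by term would accumulate factorial denominators.\<close>

lemma power_sum_poly: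
  "\<exists>q :: 'p::prime_card padic poly. degree q \<le> Suc k \<and> (\<forall>i. padic_abs (poly.coeff q i) \<le> real (Suc k))
     \<and> (\<forall>x. poly q (of_nat x) = (\<Sum>y<x. of_nat y ^ k))"
proof -
  obtain a :: "nat \<Rightarrow> int" where
    a: "\<And>x :: 'p padic. x ^ k = (\<Sum>j\<le>k. of_int (a j) * poly (falling_factorial_poly j) x)"
    using power_as_falling_factorials by blast
  define q :: "'p padic poly" where
    "q = (\<Sum>j\<le>k. Polynomial.smult (of_int (a j) / of_nat (Suc j)) (falling_factorial_poly (Suc j)))"
  have "degree q \<le> Suc k"
    unfolding q_def
  proof (rule degree_sum_le)
    fix j assume "j \<in> {..k}"
    then show "degree (Polynomial.smult (of_int (a j) / of_nat (Suc j)) (falling_factorial_poly (Suc j)) :: 'p padic poly) \<le> Suc k"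
      using degree_falling_factorial_poly_le[of "Suc j", where 'a = "'p padic"]
      by (intro order.trans[OF degree_smult_le]) auto
  qed simp
  moreover have "padic_abs (poly.coeff q i) \<le> real (Suc k)" for i
    unfolding q_def coeff_sum
  proof (rule padic_abs_sum_le)
    fix j assume j: "j \<in> {..k}"
    let ?d = "padic_abs (of_nat (Suc j) :: 'p padic)"
    have d: "1 \<le> real (Suc j) * ?d" by (rule one_le_padic_abs_of_nat) simp
    have "?d > 0"
    proof (rule ccontr)
      assume "\<not> ?d > 0"
      then have "real (Suc j) * ?d \<le> 0" by (intro mult_nonneg_nonpos) auto
      with d show False by simp
    qed
    have "padic_abs (of_int (a j) :: 'p padic) / ?d * padic_abs (poly.coeff (falling_factorial_poly (Suc j)) i :: 'p padic)
        \<le> (real (Suc j)) * 1"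
    proof (intro mult_mono)
      have "padic_abs (of_int (a j) :: 'p padic) \<le> real (Suc j) * ?d"
        using d padic_abs_of_int_le_1[of "a j", where 'p = 'p] by linarith
      then show "padic_abs (of_int (a j) :: 'p padic) / ?d \<le> real (Suc j)"
        using \<open>?d > 0\<close> by (simp add: divide_le_eq del: of_nat_Suc)
    qed (use padic_abs_coeff_falling_factorial_poly_le padic_abs_nonneg in auto)
    then show "padic_abs (poly.coeff (Polynomial.smult (of_int (a j) / of_nat (Suc j)) (falling_factorial_poly (Suc j))) i :: 'p padic)
        \<le> real (Suc k)"
      using j by (simp add: padic_abs_mult padic_abs_divide del: of_nat_Suc)
  qed simp
  moreover have "poly q (of_nat x) = (\<Sum>y<x. of_nat y ^ k)" for x
  proof -
    have "poly (falling_factorial_poly (Suc j)) (of_nat x)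
        = of_nat (Suc j) * (\<Sum>y<x. poly (falling_factorial_poly j) (of_nat y :: 'p padic))" for j
      by (rule sum_falling_factorial[symmetric])
    then have "poly q (of_nat x)
        = (\<Sum>j\<le>k. of_int (a j) * (\<Sum>y<x. poly (falling_factorial_poly j) (of_nat y)))"
      by (simp add: q_def poly_sum del: of_nat_Suc)
    also have "\<dots> = (\<Sum>y<x. \<Sum>j\<le>k. of_int (a j) * poly (falling_factorial_poly j) (of_nat y))"
      by (simp add: sum_distrib_left sum.swap[of _ "{..<x}"])
    finally show ?thesis by (simp add: a)
  qed
  ultimately show ?thesis by blast
qed

section \<open>Overconvergent power series\<close>

text \<open>The variable is \<open>x\<close> in \<open>j = i + p x\<close>. In this variable convergence on a disc of radius larger than the
  absolute value of \<open>p\<close> becomes convergence on a disc of radius larger than \<open>1\<close>, which is the same as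
  geometric decay of the coefficients.\<close>

definition overconvergent :: "(nat \<Rightarrow> 'p::prime_card padic) \<Rightarrow> bool" where
  "overconvergent g \<longleftrightarrow> (\<exists>b C \<rho>. 0 < \<rho> \<and> \<rho> < 1 \<and> (\<forall>k. padic_abs (b k) \<le> C * \<rho> ^ k) \<and>
     (\<forall>x. (\<lambda>k. b k * of_nat x ^ k) sums g x))"

lemma overconvergentI:
  assumes "0 < \<rho>" "\<rho> < 1" "\<And>k. padic_abs (b k) \<le> C * \<rho> ^ k" "\<And>x. (\<lambda>k. b k * of_nat x ^ k) sums g x"
  shows "overconvergent g"
  unfolding overconvergent_def using assms by blast

text \<open>The rate may always be weakened, which allows two functions to share one rate.\<close>

lemma overconvergentE_ge:
  assumes "overconvergent g" and "\<rho>0 < 1"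
  obtains b C \<rho> where "0 < \<rho>" "\<rho>0 \<le> \<rho>" "\<rho> < 1" "0 \<le> C" "\<And>k. padic_abs (b k) \<le> C * \<rho> ^ k"
    "\<And>x. (\<lambda>k. b k * of_nat x ^ k) sums g x"
proof -
  obtain b C \<rho> where \<rho>: "0 < \<rho>" "\<rho> < 1" and b: "\<And>k. padic_abs (b k) \<le> C * \<rho> ^ k"
    and g: "\<And>x. (\<lambda>k. b k * of_nat x ^ k) sums g x"
    using assms(1) unfolding overconvergent_def by blast
  have "0 \<le> C" using b[of 0] padic_abs_nonneg[of "b 0"] by simp
  have "padic_abs (b k) \<le> C * max \<rho>0 \<rho> ^ k" for k
  proof -
    have "\<rho> ^ k \<le> max \<rho>0 \<rho> ^ k" using \<rho> by (intro power_mono) auto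
    then show ?thesis using b[of k] mult_left_mono[OF _ \<open>0 \<le> C\<close>] by fastforce
  qed
  then show thesis using \<rho> assms(2) \<open>0 \<le> C\<close> g by (intro that[of "max \<rho>0 \<rho>" C b]) auto
qed

lemma overconvergentE:
  assumes "overconvergent g"
  obtains b C \<rho> where "0 < \<rho>" "\<rho> < 1" "0 \<le> C" "\<And>k. padic_abs (b k) \<le> C * \<rho> ^ k"
    "\<And>x. (\<lambda>k. b k * of_nat x ^ k) sums g x"
  by (rule overconvergentE_ge[OF assms zero_less_one]) (rule that)

lemma padic_abs_mult_of_nat_power_le:
  "padic_abs (b * of_nat x ^ k) \<le> padic_abs (b :: 'p::prime_card padic)"
  unfolding padic_abs_mult padic_abs_power
  by (intro mult_right_le_one_le power_le_one padic_abs_nonneg zero_le_power padic_abs_of_nat_le_1)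

lemma overconvergent_suminf:
  assumes "0 < \<rho>" "\<rho> < 1" "\<And>k. padic_abs (b k) \<le> C * \<rho> ^ k"
  shows "(\<lambda>k. b k * of_nat x ^ k) sums (\<Sum>k. b k * of_nat x ^ k :: 'p::prime_card padic)"
  by (intro summable_sums geometric_padic_series(1)[OF _ assms(1,2), where C = C]
        order.trans[OF padic_abs_mult_of_nat_power_le assms(3)])

lemma overconvergent_add:
  assumes "overconvergent g" "overconvergent h"
  shows "overconvergent (\<lambda>x. g x + h x)"
proof -
  obtain b C \<rho> where b: "0 < \<rho>" "\<rho> < 1" "0 \<le> C" "\<And>k. padic_abs (b k) \<le> C * \<rho> ^ k"
    "\<And>x. (\<lambda>k. b k * of_nat x ^ k) sums g x"
    by (rule overconvergentE[OF assms(1)]) (rule that)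
  obtain d D \<sigma> where d: "0 < \<sigma>" "\<rho> \<le> \<sigma>" "\<sigma> < 1" "0 \<le> D" "\<And>k. padic_abs (d k) \<le> D * \<sigma> ^ k"
    "\<And>x. (\<lambda>k. d k * of_nat x ^ k) sums h x"
    by (rule overconvergentE_ge[OF assms(2) b(2)]) (rule that)
  show ?thesis
  proof (rule overconvergentI[of \<sigma> "\<lambda>k. b k + d k" "C + D"])
    fix k
    have "C * \<rho> ^ k \<le> C * \<sigma> ^ k" using b d by (intro mult_left_mono power_mono) auto
    then show "padic_abs (b k + d k) \<le> (C + D) * \<sigma> ^ k"
      using padic_abs_triangle[of "b k" "d k"] b(4)[of k] d(5)[of k] by (simp add: distrib_right)
  next
    show "(\<lambda>k. (b k + d k) * of_nat x ^ k) sums (g x + h x)" for x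
      using sums_add[OF b(5)[of x] d(6)[of x]] by (simp add: distrib_right)
  qed (use d in auto)
qed

lemma overconvergent_cmult:
  assumes "overconvergent g"
  shows "overconvergent (\<lambda>x. c * g x)"
proof -
  obtain b C \<rho> where b: "0 < \<rho>" "\<rho> < 1" "0 \<le> C" "\<And>k. padic_abs (b k) \<le> C * \<rho> ^ k"
    "\<And>x. (\<lambda>k. b k * of_nat x ^ k) sums g x"
    by (rule overconvergentE[OF assms]) (rule that)
  show ?thesis
  proof (rule overconvergentI[OF b(1,2), of "\<lambda>k. c * b k" "padic_abs c * C"])
    show "padic_abs (c * b k) \<le> padic_abs c * C * \<rho> ^ k" for k
      using mult_left_mono[OF b(4) padic_abs_nonneg[of c]] by (simp add: padic_abs_mult mult_ac)
    show "(\<lambda>k. c * b k * of_nat x ^ k) sums (c * g x)" for x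
      using sums_padic_cmult[OF b(5)[of x], of c] by (simp add: mult_ac)
  qed
qed

lemma overconvergent_const: "overconvergent (\<lambda>_. c)"
proof (rule overconvergentI[of "1/2" "\<lambda>k. if k = 0 then c else 0" "padic_abs c"])
  show "(\<lambda>k. (if k = 0 then c else 0) * of_nat x ^ k) sums c" for x
    using sums_single[of 0 "\<lambda>_. c"] by (rule back_subst[of "\<lambda>f. f sums c"]) auto
qed (auto simp: padic_abs_nonneg)

text \<open>The coefficients \<open>d k\<close> of the quotient solve \<open>m * d (k + 1) + p * d k = b (k + 1)\<close>. As \<open>m\<close> is a unit, division by it
  costs nothing, and the factor \<open>p\<close> shrinks \<open>d k\<close> enough for any rate \<open>\<rho> \<ge> 1 / p\<close> to be inherited.\<close>

lemma overconvergent_divide_unit: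
  fixes g :: "nat \<Rightarrow> 'p::prime_card padic"
  assumes "overconvergent g" and m: "\<not> CARD('p) dvd m"
  shows "overconvergent (\<lambda>x. g x / of_nat (m + CARD('p) * x))"
proof -
  let ?p = "of_nat CARD('p) :: 'p padic" and ?m = "of_nat m :: 'p padic"
  have p1: "1 / real CARD('p) < 1"
    using prime_gt_1_nat[OF prime_card[where 'a = 'p]] by simp
  have m1: "padic_abs ?m = 1" by (rule padic_abs_of_nat_unit[OF m])
  then have m0: "?m \<noteq> 0" by (metis padic_abs_0 zero_neq_one)
  obtain b C \<rho> where b: "0 < \<rho>" "1 / real CARD('p) \<le> \<rho>" "\<rho> < 1" "0 \<le> C"
    "\<And>k. padic_abs (b k) \<le> C * \<rho> ^ k" "\<And>x. (\<lambda>k. b k * of_nat x ^ k) sums g x"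
    by (rule overconvergentE_ge[OF assms(1) p1]) (rule that)
  define d where "d = rec_nat (b 0 / ?m) (\<lambda>k dk. (b (Suc k) - ?p * dk) / ?m)"
  have d0: "d 0 = b 0 / ?m" and dS: "\<And>k. d (Suc k) = (b (Suc k) - ?p * d k) / ?m"
    by (simp_all add: d_def)
  have db: "padic_abs (d k) \<le> C * \<rho> ^ k" for k
  proof (induction k)
    case 0
    show ?case using b(5)[of 0] by (simp add: d0 padic_abs_divide m1)
  next
    case (Suc k)
    have "padic_abs (?p * d k) \<le> \<rho> * (C * \<rho> ^ k)"
      unfolding padic_abs_mult padic_abs_prime
      using Suc b by (intro mult_mono padic_abs_nonneg) auto
    then have "padic_abs (b (Suc k) - ?p * d k) \<le> C * \<rho> ^ Suc k"
      by (intro order.trans[OF padic_abs_diff] max.boundedI b(5)) (simp add: mult_ac)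
    then show ?case by (simp add: dS padic_abs_divide m1)
  qed
  show ?thesis
  proof (rule overconvergentI[OF b(1,3) db])
    fix x
    let ?z = "of_nat (m + CARD('p) * x) :: 'p padic"
    have "\<not> CARD('p) dvd m + CARD('p) * x" using m by (simp add: dvd_add_left_iff)
    then have z0: "?z \<noteq> 0" using padic_abs_of_nat_unit padic_abs_0 by (metis zero_neq_one)
    \<comment> \<open>The product of the divisor with a partial sum telescopes up to one boundary term, which tends to zero.\<close>
    have part: "?z * (\<Sum>k<Suc N. d k * of_nat x ^ k)
        = (\<Sum>k<Suc N. b k * of_nat x ^ k) + ?p * d N * of_nat x ^ Suc N" for N
    proof (induction N)
      case 0
      show ?case using m0 by (simp add: d0 field_simps)
    next
      case (Suc N)
      have "?m * d (Suc N) = b (Suc N) - ?p * d N" using m0 by (simp add: dS)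
      then have "?z * (d (Suc N) * of_nat x ^ Suc N) = (b (Suc N) - ?p * d N) * of_nat x ^ Suc N
          + ?p * d (Suc N) * of_nat x ^ Suc (Suc N)"
        by (simp add: distrib_right)
      then show ?case
        by (subst (1 2) sum.lessThan_Suc) (simp only: distrib_left Suc, simp add: algebra_simps)
    qed
    have "(\<lambda>N. ?p * d N * of_nat x ^ Suc N) \<longlonglongrightarrow> 0"
      unfolding tendsto_padic_iff diff_0_right
    proof (rule tendsto_sandwich[OF _ _ tendsto_const])
      show "(\<lambda>N. C * \<rho> ^ N) \<longlonglongrightarrow> 0"
        using b by (intro tendsto_mult_right_zero LIMSEQ_realpow_zero) auto
      have "padic_abs (?p * d N * of_nat x ^ Suc N) \<le> C * \<rho> ^ N" for N
      proof -
        have "padic_abs (?p * d N) \<le> padic_abs (d N)"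
          using padic_abs_mult_of_nat_power_le[of "d N" "CARD('p)" 1] by (simp add: mult.commute)
        then show ?thesis using padic_abs_mult_of_nat_power_le[of "?p * d N" x "Suc N"] db[of N] by simp
      qed
      then show "\<forall>\<^sub>F N in sequentially. padic_abs (?p * d N * of_nat x ^ Suc N) \<le> C * \<rho> ^ N" by simp
    qed (simp add: padic_abs_nonneg)
    moreover have "(\<lambda>N. \<Sum>k<Suc N. b k * of_nat x ^ k) \<longlonglongrightarrow> g x"
      using b(6)[of x] unfolding sums_def by (rule LIMSEQ_Suc)
    ultimately have "(\<lambda>N. ?z * (\<Sum>k<Suc N. d k * of_nat x ^ k)) \<longlonglongrightarrow> g x + 0"
      unfolding part by (intro tendsto_add)
    then have "(\<lambda>N. inverse ?z * (?z * (\<Sum>k<Suc N. d k * of_nat x ^ k))) \<longlonglongrightarrow> inverse ?z * g x"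
      by (intro tendsto_padic_mult tendsto_const) simp
    moreover have "inverse ?z * (?z * w) = w" for w using z0 by (simp flip: mult.assoc)
    ultimately have "(\<lambda>N. \<Sum>k<Suc N. d k * of_nat x ^ k) \<longlonglongrightarrow> g x / ?z"
      by (simp only: divide_inverse mult.commute[of "g x"])
    then show "(\<lambda>k. d k * of_nat x ^ k) sums (g x / ?z)"
      unfolding sums_def by (rule LIMSEQ_imp_Suc)
  qed
qed

lemma overconvergent_split_constant:
  fixes g :: "nat \<Rightarrow> 'p::prime_card padic"
  assumes "overconvergent g"
  shows "\<exists>c h. overconvergent h \<and> (\<forall>x. g x = c + of_nat (CARD('p) * x) * h x)"
proof -
  let ?p = "of_nat CARD('p) :: 'p padic"
  have p0: "?p \<noteq> 0" by simp
  obtain b C \<rho> where b: "0 < \<rho>" "\<rho> < 1" "0 \<le> C" "\<And>k. padic_abs (b k) \<le> C * \<rho> ^ k"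
    "\<And>x. (\<lambda>k. b k * of_nat x ^ k) sums g x"
    by (rule overconvergentE[OF assms]) (rule that)
  define d where "d k = b (Suc k) / ?p" for k
  define h where "h x = (\<Sum>k. d k * of_nat x ^ k)" for x
  have db: "padic_abs (d k) \<le> (real CARD('p) * C * \<rho>) * \<rho> ^ k" for k
    using mult_left_mono[OF b(4)[of "Suc k"], of "real CARD('p)"]
    by (simp add: d_def padic_abs_divide padic_abs_prime mult_ac)
  have hs: "(\<lambda>k. d k * of_nat x ^ k) sums h x" for x
    unfolding h_def by (rule overconvergent_suminf[OF b(1,2) db])
  have "g x = b 0 + of_nat (CARD('p) * x) * h x" for x
  proof -
    have "(\<lambda>k. of_nat (CARD('p) * x) * (d k * of_nat x ^ k)) sums (of_nat (CARD('p) * x) * h x)"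
      by (rule sums_padic_cmult[OF hs])
    moreover have "of_nat (CARD('p) * x) * (d k * of_nat x ^ k) = b (Suc k) * of_nat x ^ Suc k" for k
      using p0 by (simp add: d_def)
    ultimately have s: "(\<lambda>k. b (Suc k) * of_nat x ^ Suc k) sums (of_nat (CARD('p) * x) * h x)"
      by (simp only:)
    have "(\<lambda>N. b 0 * of_nat x ^ 0 + (\<Sum>k<N. b (Suc k) * of_nat x ^ Suc k))
        \<longlonglongrightarrow> b 0 * of_nat x ^ 0 + of_nat (CARD('p) * x) * h x"
      by (intro tendsto_add tendsto_const s[unfolded sums_def])
    then have "(\<lambda>N. \<Sum>k<Suc N. b k * of_nat x ^ k) \<longlonglongrightarrow> b 0 + of_nat (CARD('p) * x) * h x"
      by (subst sum.lessThan_Suc_shift) simp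
    moreover have "(\<lambda>N. \<Sum>k<Suc N. b k * of_nat x ^ k) \<longlonglongrightarrow> g x"
      using b(5)[of x] unfolding sums_def by (rule LIMSEQ_Suc)
    ultimately show ?thesis using LIMSEQ_unique by blast
  qed
  moreover have "overconvergent h" by (rule overconvergentI[OF b(1,2) db hs])
  ultimately show ?thesis by blast
qed

lemma linear_times_geometric_bounded:
  fixes \<rho> \<sigma> :: real
  assumes "0 < \<rho>" "\<rho> < \<sigma>"
  obtains K where "0 \<le> K" "\<And>k. real (Suc k) * \<rho> ^ k \<le> K * \<sigma> ^ k"
proof -
  let ?q = "\<rho> / \<sigma>"
  have q: "0 < ?q" "?q < 1" using assms by auto
  have "(\<lambda>k. real k * ?q ^ k + ?q ^ k) \<longlonglongrightarrow> 0 + 0"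
    using q by (intro tendsto_add LIMSEQ_realpow_zero powser_times_n_limit_0) auto
  then have "Bseq (\<lambda>k. real k * ?q ^ k + ?q ^ k)" by (intro convergent_imp_Bseq convergentI)
  then obtain K where K: "K > 0" "\<And>k. \<bar>real k * ?q ^ k + ?q ^ k\<bar> \<le> K" by (auto elim!: BseqE)
  have "real (Suc k) * \<rho> ^ k \<le> K * \<sigma> ^ k" for k
  proof -
    have "real (Suc k) * ?q ^ k \<le> K" using K(2)[of k] by (simp add: algebra_simps)
    then show ?thesis using assms by (simp add: power_divide divide_le_eq)
  qed
  with K show thesis by (intro that[of K]) auto
qed

text \<open>The antidifference is \<open>\<Sum>k. b k * S k x\<close> where \<open>S k\<close> is the \<open>k\<close>-th power sum polynomial; collecting powers of
  \<open>x\<close> gives the coefficients \<open>e i\<close>. The rate \<open>\<sigma> > \<rho>\<close> absorbs the factor \<open>k + 1\<close> bounding the coefficients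
  of \<open>S k\<close>.\<close>

lemma overconvergent_sum:
  fixes g :: "nat \<Rightarrow> 'p::prime_card padic"
  assumes "overconvergent g"
  shows "overconvergent (\<lambda>x. \<Sum>y<x. g y)"
proof -
  obtain b C \<rho> where b: "0 < \<rho>" "\<rho> < 1" "0 \<le> C" "\<And>k. padic_abs (b k) \<le> C * \<rho> ^ k"
    "\<And>x. (\<lambda>k. b k * of_nat x ^ k) sums g x"
    by (rule overconvergentE[OF assms]) (rule that)
  obtain \<sigma> where \<sigma>: "\<rho> < \<sigma>" "\<sigma> < 1" using dense[OF b(2)] by blast
  obtain K where K: "0 \<le> K" "\<And>k. real (Suc k) * \<rho> ^ k \<le> K * \<sigma> ^ k"
    using linear_times_geometric_bounded[OF b(1) \<sigma>(1)] by blast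
  have \<sigma>0: "0 < \<sigma>" using b \<sigma> by linarith
  obtain q :: "nat \<Rightarrow> 'p padic poly" where
    dq: "\<And>k. degree (q k) \<le> Suc k" and cq: "\<And>k i. padic_abs (poly.coeff (q k) i) \<le> real (Suc k)"
    and q: "\<And>k x. poly (q k) (of_nat x) = (\<Sum>y<x. of_nat y ^ k)"
    using power_sum_poly by metis
  define w where "w i k = b k * poly.coeff (q k) i" for i k
  define e where "e i = suminf (w i)" for i
  have w: "padic_abs (w i k) \<le> (C * K) * \<sigma> ^ k" for i k
  proof -
    have "padic_abs (w i k) \<le> (C * \<rho> ^ k) * real (Suc k)"
      unfolding w_def padic_abs_mult
      using b by (intro mult_mono b(4) cq padic_abs_nonneg) auto
    also have "\<dots> = C * (real (Suc k) * \<rho> ^ k)" by (simp add: mult_ac)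
    also have "\<dots> \<le> C * (K * \<sigma> ^ k)" by (intro mult_left_mono K b)
    finally show ?thesis by (simp add: mult_ac)
  qed
  have tail: "padic_abs (e i - (\<Sum>k<N. w i k)) \<le> (C * K) * \<sigma> ^ N" for i N
    unfolding e_def by (rule geometric_padic_series(2)[OF w \<sigma>0 \<sigma>(2)])
  show ?thesis
  proof (rule overconvergentI[OF \<sigma>0 \<sigma>(2), of e "C * K / \<sigma>"])
    fix i
    \<comment> \<open>The power \<open>x ^ i\<close> occurs only in those \<open>S k\<close> with \<open>k + 1 \<ge> i\<close>, so \<open>e i\<close> is entirely a tail.\<close>
    have "(\<Sum>k<i - 1. w i k) = 0"
    proof (intro sum.neutral ballI)
      fix k assume "k \<in> {..<i - 1}"
      then have "degree (q k) < i" using dq[of k] by simp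
      then show "w i k = 0" by (simp add: w_def coeff_eq_0)
    qed
    then have "padic_abs (e i) \<le> (C * K) * \<sigma> ^ (i - 1)" using tail[of i "i - 1"] by simp
    also have "\<dots> \<le> C * K / \<sigma> * \<sigma> ^ i"
    proof (cases i)
      case 0
      then show ?thesis using \<sigma>0 \<sigma>(2) b(3) K(1) by (simp add: le_divide_eq mult_left_le)
    qed (use \<sigma>0 in simp)
    finally show "padic_abs (e i) \<le> C * K / \<sigma> * \<sigma> ^ i" .
  next
    fix x
    let ?S = "\<Sum>y<x. g y"
    have S: "(\<lambda>N. \<Sum>k<N. b k * poly (q k) (of_nat x)) \<longlonglongrightarrow> ?S"
    proof -
      have "(\<lambda>N. \<Sum>y<x. \<Sum>k<N. b k * of_nat y ^ k) \<longlonglongrightarrow> ?S"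
        by (intro tendsto_sum b(5)[unfolded sums_def])
      then show ?thesis by (simp add: q sum_distrib_left sum.swap[of _ "{..<x}"])
    qed
    have poly_eq: "poly (q k) (of_nat x) = (\<Sum>i\<le>N. poly.coeff (q k) i * of_nat x ^ i)" if "k < N" for k N
      unfolding poly_altdef using dq[of k] that
      by (intro sum.mono_neutral_left) (auto simp: coeff_eq_0 not_le)
    \<comment> \<open>The polynomials with \<open>k < N\<close> have degree at most \<open>N\<close>, so cutting off both summations leaves only the tails
      of the \<open>e i\<close>. This justifies interchanging the two limits.\<close>
    have diff: "padic_abs ((\<Sum>i<Suc N. e i * of_nat x ^ i) - (\<Sum>k<N. b k * poly (q k) (of_nat x)))
        \<le> (C * K) * \<sigma> ^ N" for N
    proof -
      have "(\<Sum>k<N. b k * poly (q k) (of_nat x)) = (\<Sum>k<N. \<Sum>i\<le>N. w i k * of_nat x ^ i)"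
        by (intro sum.cong refl) (simp add: poly_eq[of _ N] sum_distrib_left w_def mult.assoc)
      also have "\<dots> = (\<Sum>i\<le>N. (\<Sum>k<N. w i k) * of_nat x ^ i)"
        by (subst sum.swap) (simp add: sum_distrib_right)
      finally have "(\<Sum>i<Suc N. e i * of_nat x ^ i) - (\<Sum>k<N. b k * poly (q k) (of_nat x))
          = (\<Sum>i\<le>N. (e i - (\<Sum>k<N. w i k)) * of_nat x ^ i)"
        by (simp add: lessThan_Suc_atMost left_diff_distrib sum_subtractf del: sum.lessThan_Suc)
      also have "padic_abs \<dots> \<le> (C * K) * \<sigma> ^ N"
        using \<sigma>0 b(3) K(1)
        by (intro padic_abs_sum_le order.trans[OF padic_abs_mult_of_nat_power_le tail]) auto
      finally show ?thesis .
    qed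
    have "(\<lambda>N. (\<Sum>i<Suc N. e i * of_nat x ^ i) - (\<Sum>k<N. b k * poly (q k) (of_nat x))) \<longlonglongrightarrow> 0"
      unfolding tendsto_padic_iff diff_0_right
    proof (rule tendsto_sandwich[OF _ _ tendsto_const])
      show "(\<lambda>N. C * K * \<sigma> ^ N) \<longlonglongrightarrow> 0"
        using \<sigma>0 \<sigma>(2) by (intro tendsto_mult_right_zero LIMSEQ_realpow_zero) auto
    qed (simp_all add: diff padic_abs_nonneg del: sum.lessThan_Suc)
    from tendsto_add[OF this S] have "(\<lambda>N. \<Sum>i<Suc N. e i * of_nat x ^ i) \<longlonglongrightarrow> ?S"
      by (simp del: sum.lessThan_Suc)
    then show "(\<lambda>i. e i * of_nat x ^ i) sums ?S"
      unfolding sums_def by (rule LIMSEQ_imp_Suc)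
  qed
qed

section \<open>Power series functions\<close>

text \<open>Substituting \<open>a - i = p x\<close> multiplies the \<open>k\<close>-th coefficient by \<open>p ^ k\<close>; a radius \<open>r\<close> corresponds to the rate
  \<open>1 / (r p)\<close>, and conversely any radius \<open>1 / (p \<sigma>)\<close> with \<open>\<rho> < \<sigma> < 1\<close> is available for a function of rate \<open>\<rho>\<close>.\<close>

lemma power_series_functions_iff:
  fixes f :: "nat \<Rightarrow> 'p::prime_card padic"
  shows "f \<in> power_series_functions \<longleftrightarrow> (\<forall>i<CARD('p). overconvergent (\<lambda>x. f (i + CARD('p) * x)))"
proof -
  let ?p = "of_nat CARD('p) :: 'p padic" and ?q = "real CARD('p)"
  have q: "0 < ?q" by simp
  have p0: "?p \<noteq> 0" by simp
  have rescale: "B / (1 / Q) ^ k * (1 / (Q * s)) ^ k = B / s ^ k" if "Q \<noteq> 0" for B Q s :: real and k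
    using that by (simp add: power_divide power_mult_distrib)
  have rescale_p: "B / P ^ k * (P * y) ^ k = B * y ^ k" if "P \<noteq> 0" for B P y :: "'p padic" and k
    using that by (simp add: power_mult_distrib)
  show ?thesis
  proof (intro iffI allI impI)
    fix i assume "f \<in> power_series_functions" and i: "i < CARD('p)"
    then obtain c r where r: "r > padic_abs ?p" and c: "converges_on_disc c r"
      and f: "\<And>a. [a = i] (mod CARD('p)) \<Longrightarrow> (\<lambda>k. c k * (of_nat a - of_nat i) ^ k) sums f a"
      unfolding power_series_functions_def power_series_function_from_def by force
    from r have r: "1 / ?q < r" by (simp add: padic_abs_prime)
    then have r0: "0 < r" using q by (meson divide_pos_pos less_trans zero_less_one)
    have "Bseq (\<lambda>k. padic_abs (c k) * r ^ k)"
      using c unfolding converges_on_disc_def by (intro convergent_imp_Bseq convergentI)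
    then obtain C where "0 < C" "\<forall>k. norm (padic_abs (c k) * r ^ k) \<le> C" by (rule BseqE)
    then have C: "\<bar>padic_abs (c k) * r ^ k\<bar> \<le> C" for k by simp
    show "overconvergent (\<lambda>x. f (i + CARD('p) * x))"
    proof (rule overconvergentI[of "1 / (r * ?q)" "\<lambda>k. c k * ?p ^ k" C])
      show "0 < 1 / (r * ?q)" "1 / (r * ?q) < 1" using r r0 q by (simp_all add: field_simps)
      show "padic_abs (c k * ?p ^ k) \<le> C * (1 / (r * ?q)) ^ k" for k
      proof -
        have "padic_abs (c k) * r ^ k \<le> C" using C[of k] by linarith
        then have "padic_abs (c k) \<le> C / r ^ k" using r0 by (simp add: le_divide_eq)
        then have "padic_abs (c k) / ?q ^ k \<le> C / r ^ k / ?q ^ k"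
          by (intro divide_right_mono) simp_all
        then show ?thesis
          by (simp add: padic_abs_mult padic_abs_power padic_abs_prime power_divide power_mult_distrib)
      qed
      show "(\<lambda>k. c k * ?p ^ k * of_nat x ^ k) sums f (i + CARD('p) * x)" for x
        using f[of "i + CARD('p) * x"] by (simp add: cong_def power_mult_distrib mult.assoc)
    qed
  next
    assume oc: "\<forall>i<CARD('p). overconvergent (\<lambda>x. f (i + CARD('p) * x))"
    show "f \<in> power_series_functions"
      unfolding power_series_functions_def power_series_function_from_def mem_Collect_eq
    proof (intro allI impI)
      fix i assume i: "i < CARD('p)"
      then have "overconvergent (\<lambda>x. f (i + CARD('p) * x))" using oc by blast
      then obtain b C \<rho> where b: "0 < \<rho>" "\<rho> < 1" "0 \<le> C" "\<And>k. padic_abs (b k) \<le> C * \<rho> ^ k"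
        "\<And>x. (\<lambda>k. b k * of_nat x ^ k) sums f (i + CARD('p) * x)"
        by (rule overconvergentE) (rule that)
      obtain \<sigma> where \<sigma>: "\<rho> < \<sigma>" "\<sigma> < 1" using dense[OF b(2)] by blast
      have \<sigma>0: "0 < \<sigma>" using b \<sigma> by linarith
      let ?r = "1 / (?q * \<sigma>)" and ?c = "\<lambda>k. b k / ?p ^ k"
      have gt: "?r > padic_abs ?p"
      proof -
        have "?q * \<sigma> < ?q" using mult_strict_left_mono[OF \<sigma>(2) q] by simp
        then show ?thesis
          unfolding padic_abs_prime using q \<sigma>0 by (intro divide_strict_left_mono mult_pos_pos) simp_all
      qed
      have conv: "converges_on_disc ?c ?r"
        unfolding converges_on_disc_def
      proof (rule tendsto_sandwich[OF _ _ tendsto_const])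
        show "(\<lambda>k. C * (\<rho> / \<sigma>) ^ k) \<longlonglongrightarrow> 0"
          using b \<sigma> by (intro tendsto_mult_right_zero LIMSEQ_realpow_zero) auto
        have "padic_abs (?c k) * ?r ^ k \<le> C * (\<rho> / \<sigma>) ^ k" for k
        proof -
          have "padic_abs (?c k) * ?r ^ k = padic_abs (b k) / \<sigma> ^ k"
            unfolding padic_abs_divide padic_abs_power padic_abs_prime
            by (rule rescale) (use q in simp)
          also have "\<dots> \<le> C * \<rho> ^ k / \<sigma> ^ k" using \<sigma>0 b(4) by (intro divide_right_mono) auto
          finally show ?thesis by (simp add: power_divide)
        qed
        then show "\<forall>\<^sub>F k in sequentially. padic_abs (?c k) * ?r ^ k \<le> C * (\<rho> / \<sigma>) ^ k" by simp
      qed (use \<sigma>0 q in \<open>simp add: padic_abs_nonneg\<close>)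
      have sums: "(\<lambda>k. ?c k * (of_nat a - of_nat i) ^ k) sums f a" if "[a = i] (mod CARD('p))" for a
      proof -
        have "a mod CARD('p) = i" using that i by (simp add: cong_def)
        then have a: "i + CARD('p) * (a div CARD('p)) = a"
          using mod_mult_div_eq[of a "CARD('p)"] by (simp only:)
        have "(\<lambda>k. ?c k * (of_nat (i + CARD('p) * x) - of_nat i) ^ k) sums f (i + CARD('p) * x)" for x
        proof -
          have "of_nat (i + CARD('p) * x) - of_nat i = ?p * of_nat x" by simp
          then show ?thesis using b(5)[of x] by (simp only: rescale_p[OF p0])
        qed
        from this[of "a div CARD('p)"] show ?thesis by (simp only: a)
      qed
      show "\<exists>c r. padic_abs ?p < r \<and> converges_on_disc c r \<and>
          (\<forall>a\<ge>0. [a = i] (mod CARD('p)) \<longrightarrow> (\<lambda>k. c k * (of_nat a - of_nat i) ^ k) sums f a)"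
        by (intro exI[of _ ?c] exI[of _ ?r] conjI allI impI gt conv sums)
    qed
  qed
qed

lemma power_series_functions_add:
  "f \<in> power_series_functions \<Longrightarrow> g \<in> power_series_functions \<Longrightarrow> (\<lambda>n. f n + g n) \<in> power_series_functions"
  by (simp add: power_series_functions_iff overconvergent_add)

lemma power_series_functions_cmult:
  "f \<in> power_series_functions \<Longrightarrow> (\<lambda>n. c * f n) \<in> power_series_functions"
  by (simp add: power_series_functions_iff overconvergent_cmult)

lemma power_series_functions_const: "(\<lambda>_. c) \<in> power_series_functions"
  by (simp add: power_series_functions_iff overconvergent_const)

lemma power_series_functions_restrict:
  fixes f :: "nat \<Rightarrow> 'p::prime_card padic"
  assumes "overconvergent (\<lambda>x. f (m + CARD('p) * x))"
  shows "(\<lambda>n. if n mod CARD('p) = m then f n else 0) \<in> power_series_functions"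
  unfolding power_series_functions_iff
proof (intro allI impI)
  fix i assume "i < CARD('p)"
  then show "overconvergent (\<lambda>x. if (i + CARD('p) * x) mod CARD('p) = m then f (i + CARD('p) * x) else 0)"
    using assms overconvergent_const[of 0] by (cases "i = m") simp_all
qed

text \<open>For \<open>n = i + p x\<close> the elements of the class of \<open>m\<close> below \<open>n\<close> are \<open>m + p y\<close> with \<open>y < x\<close>, and also \<open>y = x\<close> if
  \<open>m < i\<close>. So \<open>H\<close> is on every class an antidifference of an overconvergent function, up to one further
  value of that function.\<close>

lemma power_series_functions_antidifference:
  fixes f :: "nat \<Rightarrow> 'p::prime_card padic"
  assumes f: "f \<in> power_series_functions" and m: "m < CARD('p)"
  shows "\<exists>H \<in> power_series_functions.
    \<forall>n. H (Suc n) = H n + (if n mod CARD('p) = m then f n else 0)"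
proof
  let ?H = "\<lambda>n. \<Sum>j<n. if j mod CARD('p) = m then f j else 0"
  let ?S = "\<lambda>x. \<Sum>y<x. f (m + CARD('p) * y)"
  have S: "overconvergent ?S" "overconvergent (\<lambda>x. f (m + CARD('p) * x))"
    using f m overconvergent_sum by (auto simp: power_series_functions_iff)
  have H: "?H (i + CARD('p) * x) = (if m < i then ?S x + f (m + CARD('p) * x) else ?S x)"
    if i: "i < CARD('p)" for i x
  proof -
    let ?x = "if m < i then Suc x else x"
    have less: "m + CARD('p) * y < i + CARD('p) * x \<longleftrightarrow> y < ?x" for y
    proof (cases y x rule: linorder_cases)
      case less
      then have "CARD('p) * Suc y \<le> CARD('p) * x" by (intro mult_le_mono2) simp
      then have "m + CARD('p) * y < i + CARD('p) * x" using m by simp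
      then show ?thesis using less by simp
    next
      case greater
      then have "CARD('p) * Suc x \<le> CARD('p) * y" by (intro mult_le_mono2) simp
      then have "\<not> m + CARD('p) * y < i + CARD('p) * x" using i by simp
      then show ?thesis using greater by simp
    qed auto
    have "{j. j < i + CARD('p) * x \<and> j mod CARD('p) = m} = (\<lambda>y. m + CARD('p) * y) ` {..<?x}"
    proof (intro equalityI subsetI)
      fix j assume "j \<in> {j. j < i + CARD('p) * x \<and> j mod CARD('p) = m}"
      then have j: "j < i + CARD('p) * x" "m + CARD('p) * (j div CARD('p)) = j" by auto
      show "j \<in> (\<lambda>y. m + CARD('p) * y) ` {..<?x}"
      proof (rule image_eqI)
        show "j = m + CARD('p) * (j div CARD('p))" by (simp only: j(2))
        show "j div CARD('p) \<in> {..<?x}"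
          unfolding lessThan_iff less[symmetric] j(2) by (rule j(1))
      qed
    next
      fix j assume "j \<in> (\<lambda>y. m + CARD('p) * y) ` {..<?x}"
      then obtain y where y: "j = m + CARD('p) * y" "y < ?x" by blast
      then have "j < i + CARD('p) * x" by (simp only: less)
      moreover have "j mod CARD('p) = m" using m by (simp add: y(1))
      ultimately show "j \<in> {j. j < i + CARD('p) * x \<and> j mod CARD('p) = m}" by simp
    qed
    then have "(\<Sum>j | j < i + CARD('p) * x \<and> j mod CARD('p) = m. f j) = ?S ?x"
      by (simp add: sum.reindex inj_on_def)
    moreover have "?H (i + CARD('p) * x) = (\<Sum>j | j < i + CARD('p) * x \<and> j mod CARD('p) = m. f j)"
      by (subst sum.inter_filter[symmetric]) simp_all
    ultimately show ?thesis by simp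
  qed
  show "?H \<in> power_series_functions"
    unfolding power_series_functions_iff
  proof (intro allI impI)
    fix i assume "i < CARD('p)"
    then show "overconvergent (\<lambda>x. ?H (i + CARD('p) * x))"
      unfolding H[OF \<open>i < CARD('p)\<close>] using S overconvergent_add[OF S] by (cases "m < i") simp_all
  qed
  show "\<forall>n. ?H (Suc n) = ?H n + (if n mod CARD('p) = m then f n else 0)" by simp
qed

text \<open>Only the class \<open>0\<close> produces a constant term that is not divisible by \<open>j\<close>. This constant is the source of the
  generators of the module.\<close>

lemma power_series_functions_divide:
  fixes f :: "nat \<Rightarrow> 'p::prime_card padic"
  assumes f: "f \<in> power_series_functions" and m: "m < CARD('p)"
  shows "\<exists>h \<in> power_series_functions. \<exists>c. (m \<noteq> 0 \<longrightarrow> c = 0) \<and>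
    (\<forall>j>0. j mod CARD('p) = m \<longrightarrow> f j = c + of_nat j * h j)"
proof (cases "m = 0")
  case True
  have "overconvergent (\<lambda>x. f (m + CARD('p) * x))"
    by (rule f[unfolded power_series_functions_iff, rule_format, OF m])
  then have "overconvergent (\<lambda>x. f (CARD('p) * x))" by (simp add: True)
  then obtain c h where h: "overconvergent h" "\<And>x. f (CARD('p) * x) = c + of_nat (CARD('p) * x) * h x"
    using overconvergent_split_constant by blast
  let ?h = "\<lambda>n. if n mod CARD('p) = 0 then h (n div CARD('p)) else 0"
  have F: "?h \<in> power_series_functions"
    by (rule power_series_functions_restrict) (use h(1) in simp)
  have eq: "f j = c + of_nat j * ?h j" if "j mod CARD('p) = 0" for j
  proof -
    have "CARD('p) * (j div CARD('p)) = j" using that by auto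
    with h(2)[of "j div CARD('p)"] have "f j = c + of_nat j * h (j div CARD('p))" by (simp only:)
    then show ?thesis by (simp only: that if_True simp_thms)
  qed
  show ?thesis
    unfolding True by (intro bexI[of _ ?h, OF _ F] exI[of _ c] conjI allI impI eq) simp
next
  case False
  let ?h = "\<lambda>n. if n mod CARD('p) = m then f n / of_nat n else 0"
  have "\<not> CARD('p) dvd m" using False m by (auto dest: dvd_imp_le)
  then have F: "?h \<in> power_series_functions"
    using f m by (intro power_series_functions_restrict overconvergent_divide_unit)
      (auto simp: power_series_functions_iff)
  have eq: "f j = 0 + of_nat j * ?h j" if "j > 0" "j mod CARD('p) = m" for j
    using that by simp
  show ?thesis
    by (intro bexI[of _ ?h, OF _ F] exI[of _ 0] conjI allI impI eq refl)
qed

section \<open>Summation over a residue class\<close>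

definition class_sum :: "nat \<Rightarrow> (nat \<Rightarrow> 'p::prime_card padic) \<Rightarrow> nat \<Rightarrow> 'p padic" where
  "class_sum m g n = (\<Sum>j | 0 < j \<and> j < n \<and> j mod CARD('p) = m. g j)"

lemma class_sum_0 [simp]: "class_sum m g 0 = 0"
  by (simp add: class_sum_def)

lemma class_sum_Suc:
  "class_sum m (g :: nat \<Rightarrow> 'p::prime_card padic) (Suc n)
     = class_sum m g n + (if 0 < n \<and> n mod CARD('p) = m then g n else 0)"
proof -
  have "{j. 0 < j \<and> j < Suc n \<and> j mod CARD('p) = m}
      = {j. 0 < j \<and> j < n \<and> j mod CARD('p) = m} \<union> (if 0 < n \<and> n mod CARD('p) = m then {n} else {})"
    by (auto simp: less_Suc_eq)
  then show ?thesis by (simp add: class_sum_def)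
qed

lemma class_sum_add: "class_sum m (\<lambda>j. g j + h j) n = class_sum m g n + class_sum m h n"
  by (simp add: class_sum_def sum.distrib)

lemma class_sum_cmult: "class_sum m (\<lambda>j. c * g j) n = c * class_sum m g n"
  by (simp add: class_sum_def sum_distrib_left)

lemma class_sum_cong:
  fixes g h :: "nat \<Rightarrow> 'p::prime_card padic"
  assumes "\<And>j. 0 < j \<Longrightarrow> j mod CARD('p) = m \<Longrightarrow> g j = h j"
  shows "class_sum m g n = class_sum m h n"
  unfolding class_sum_def using assms by (intro sum.cong) auto

text \<open>The sums are split at the last entry because it is the largest one: it bounds all the others, which thus form an
  index of the same kind with upper limit \<open>j\<close>.\<close>

lemma harmonic_index_snoc_iff:
  "ns @ [j] \<in> harmonic_index p (m @ [b]) n \<longleftrightarrow>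
     0 < j \<and> j < n \<and> [j = b] (mod p) \<and> ns \<in> harmonic_index p m j"
proof -
  have "ns @ [j] \<in> harmonic_index p (m @ [b]) n \<longleftrightarrow> length ns = length m \<and>
      sorted_wrt (<) ns \<and> (\<forall>i<length m. ns ! i < j) \<and>
      (\<forall>i<length m. 0 < ns ! i \<and> ns ! i < n \<and> [ns ! i = m ! i] (mod p)) \<and>
      0 < j \<and> j < n \<and> [j = b] (mod p)"
    unfolding harmonic_index_def
    by (auto simp: sorted_wrt_append all_set_conv_all_nth nth_append less_Suc_eq)
  then show ?thesis
    by (auto simp: harmonic_index_def intro: less_trans)
qed

lemma mh_sum_snoc:
  assumes len: "length s = length m" and b: "b < CARD('p::prime_card)"
  shows "(mh_sum (s @ [a]) (m @ [b]) n :: 'p padic)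
    = class_sum b (\<lambda>j. mh_sum s m j / of_nat j ^ a) n"
proof -
  let ?J = "{j. 0 < j \<and> j < n \<and> j mod CARD('p) = b}"
  let ?t = "\<lambda>ns. \<Prod>i<length s. of_nat (ns ! i) ^ (s ! i) :: 'p padic"
  have fin: "finite ?J" by simp
  have "class_sum b (\<lambda>j. mh_sum s m j / of_nat j ^ a) n
      = (\<Sum>j\<in>?J. \<Sum>ns\<in>harmonic_index CARD('p) m j. 1 / ?t ns / of_nat j ^ a)"
    by (simp add: class_sum_def mh_sum_def sum_divide_distrib)
  also have "\<dots> = (\<Sum>(j, ns)\<in>Sigma ?J (harmonic_index CARD('p) m). 1 / ?t ns / of_nat j ^ a)"
    by (rule sum.Sigma[OF fin]) (simp add: finite_harmonic_index)
  also have "\<dots> = mh_sum (s @ [a]) (m @ [b]) n"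
    unfolding mh_sum_def
  proof (rule sum.reindex_bij_witness[of _ "\<lambda>ns. (last ns, butlast ns)" "\<lambda>(j, ns). ns @ [j]"], goal_cases)
    case (1 x)
    then show ?case by auto
  next
    case (2 x)
    then show ?case using b by (auto simp: harmonic_index_snoc_iff cong_def)
  next
    case (3 ns)
    then have "ns \<noteq> []" by (auto simp: harmonic_index_def)
    then show ?case by simp
  next
    case (4 ns)
    then have "ns \<noteq> []" by (auto simp: harmonic_index_def)
    then have "butlast ns @ [last ns] \<in> harmonic_index CARD('p) (m @ [b]) n" using 4 by simp
    then show ?case unfolding harmonic_index_snoc_iff using b by (simp add: cong_def)
  next
    case (5 x)
    obtain j ns where x: "x = (j, ns)" by (cases x)
    then have l: "length ns = length s" using 5 len by (simp add: harmonic_index_def)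
    have "(\<Prod>i<length s. of_nat ((ns @ [j]) ! i) ^ ((s @ [a]) ! i)) = ?t ns"
      using l by (intro prod.cong refl) (simp add: nth_append)
    moreover have "(ns @ [j]) ! length s = j" using l by (metis nth_append_length)
    ultimately show ?case by (simp add: x)
  qed
  finally show ?thesis by simp
qed

lemma mh_sum_p_snoc:
  "(mh_sum_p (t @ [a]) n :: 'p::prime_card padic) = class_sum 0 (\<lambda>j. mh_sum_p t j / of_nat j ^ a) n"
  unfolding mh_sum_p_def length_append_singleton replicate_Suc replicate_append_same[symmetric]
  by (rule mh_sum_snoc) simp_all

section \<open>The module of multiple harmonic sums\<close>

lemma mh_sum_module_cong:
  assumes "g \<in> mh_sum_module" "\<And>n. n \<ge> 1 \<Longrightarrow> h n = g n"
  shows "h \<in> mh_sum_module"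
  using assms unfolding mh_sum_module_def by simp

lemma mh_sum_module_generator:
  assumes "f \<in> power_series_functions" "\<And>x. x \<in> set t \<Longrightarrow> 0 < x"
  shows "(\<lambda>n. f n * mh_sum_p t n) \<in> mh_sum_module"
  unfolding mh_sum_module_def mem_Collect_eq
  by (intro exI[of _ "{t}"] exI[of _ "\<lambda>_. f"]) (use assms in auto)

lemma mh_sum_module_cmult:
  assumes "g \<in> mh_sum_module"
  shows "(\<lambda>n. c * g n) \<in> mh_sum_module"
proof -
  obtain S f where S: "finite S" "\<And>t. t \<in> S \<Longrightarrow> (\<forall>x\<in>set t. 0 < x) \<and> f t \<in> power_series_functions"
    "\<And>n. n \<ge> 1 \<Longrightarrow> g n = (\<Sum>t\<in>S. f t n * mh_sum_p t n)"
    using assms unfolding mh_sum_module_def by blast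
  then show ?thesis
    unfolding mh_sum_module_def mem_Collect_eq
    by (intro exI[of _ S] exI[of _ "\<lambda>t n. c * f t n"])
      (auto simp: sum_distrib_left mult_ac intro: power_series_functions_cmult)
qed

lemma mh_sum_module_add:
  assumes "g \<in> mh_sum_module" "h \<in> mh_sum_module"
  shows "(\<lambda>n. g n + h n) \<in> mh_sum_module"
proof -
  obtain S f where S: "finite S" "\<And>t. t \<in> S \<Longrightarrow> (\<forall>x\<in>set t. 0 < x) \<and> f t \<in> power_series_functions"
    "\<And>n. n \<ge> 1 \<Longrightarrow> g n = (\<Sum>t\<in>S. f t n * mh_sum_p t n)"
    using assms(1) unfolding mh_sum_module_def by blast
  obtain S' f' where S': "finite S'" "\<And>t. t \<in> S' \<Longrightarrow> (\<forall>x\<in>set t. 0 < x) \<and> f' t \<in> power_series_functions"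
    "\<And>n. n \<ge> 1 \<Longrightarrow> h n = (\<Sum>t\<in>S'. f' t n * mh_sum_p t n)"
    using assms(2) unfolding mh_sum_module_def by blast
  define F where "F t n = (if t \<in> S then f t n else 0) + (if t \<in> S' then f' t n else 0)" for t n
  have "F t \<in> power_series_functions" if "t \<in> S \<union> S'" for t
    unfolding F_def
  proof (rule power_series_functions_add)
    show "(\<lambda>n. if t \<in> S then f t n else 0) \<in> power_series_functions"
      using S(2)[of t] by (cases "t \<in> S") (simp_all add: power_series_functions_const)
    show "(\<lambda>n. if t \<in> S' then f' t n else 0) \<in> power_series_functions"
      using S'(2)[of t] by (cases "t \<in> S'") (simp_all add: power_series_functions_const)
  qed
  moreover have "g n + h n = (\<Sum>t\<in>S \<union> S'. F t n * mh_sum_p t n)" if "n \<ge> 1" for n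
  proof -
    have "g n = (\<Sum>t\<in>S \<union> S'. (if t \<in> S then f t n else 0) * mh_sum_p t n)"
      unfolding S(3)[OF that] using S(1) S'(1) by (intro sum.mono_neutral_cong_left) auto
    moreover have "h n = (\<Sum>t\<in>S \<union> S'. (if t \<in> S' then f' t n else 0) * mh_sum_p t n)"
      unfolding S'(3)[OF that] using S(1) S'(1) by (intro sum.mono_neutral_cong_left) auto
    ultimately show ?thesis by (simp add: F_def distrib_right sum.distrib)
  qed
  ultimately show ?thesis
    unfolding mh_sum_module_def mem_Collect_eq
    using S S' by (intro exI[of _ "S \<union> S'"] exI[of _ F]) auto
qed

lemma mh_sum_module_sum:
  assumes "finite S" "\<And>t. t \<in> S \<Longrightarrow> g t \<in> mh_sum_module"
  shows "(\<lambda>n. \<Sum>t\<in>S. g t n) \<in> (mh_sum_module :: (nat \<Rightarrow> 'p::prime_card padic) set)"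
  using assms
proof (induction S rule: finite_induct)
  case empty
  then show ?case
    using mh_sum_module_generator[OF power_series_functions_const[of 0], of "[]"] by simp
next
  case (insert t S)
  then show ?case by (simp add: mh_sum_module_add)
qed

text \<open>Each step removes one factor \<open>j\<close> from the denominator by dividing the power series function; on the class
  \<open>0\<close> the constant left over contributes a multiple of the generator \<open>mh_sum_p (t @ [Suc s])\<close>.\<close>

lemma class_sum_divide_power_in_module:
  fixes f :: "nat \<Rightarrow> 'p::prime_card padic"
  assumes t: "\<And>x. x \<in> set t \<Longrightarrow> 0 < x" and m: "m < CARD('p)"
    and base: "\<And>f :: nat \<Rightarrow> 'p padic. f \<in> power_series_functions \<Longrightarrow>
        class_sum m (\<lambda>j. f j * mh_sum_p t j) \<in> mh_sum_module"
    and f: "f \<in> power_series_functions"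
  shows "class_sum m (\<lambda>j. f j * mh_sum_p t j / of_nat j ^ s) \<in> mh_sum_module"
  using f
proof (induction s arbitrary: f)
  case 0
  then show ?case using base by simp
next
  case (Suc s)
  obtain h c where h: "h \<in> power_series_functions" and c: "m \<noteq> 0 \<longrightarrow> c = 0"
    and fh: "\<And>j. j > 0 \<Longrightarrow> j mod CARD('p) = m \<Longrightarrow> f j = c + of_nat j * h j"
    using power_series_functions_divide[OF Suc.prems m] by blast
  have eq: "class_sum m (\<lambda>j. f j * mh_sum_p t j / of_nat j ^ Suc s) n
      = c * class_sum m (\<lambda>j. mh_sum_p t j / of_nat j ^ Suc s) n
        + class_sum m (\<lambda>j. h j * mh_sum_p t j / of_nat j ^ s) n" for n
    unfolding class_sum_cmult[symmetric] class_sum_add[symmetric]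
    by (rule class_sum_cong) (simp add: fh field_simps)
  have "(\<lambda>n. c * class_sum m (\<lambda>j. mh_sum_p t j / of_nat j ^ Suc s) n) \<in> mh_sum_module"
  proof (cases "m = 0")
    case True
    have "(\<lambda>n. c * mh_sum_p (t @ [Suc s]) n) \<in> mh_sum_module"
      using t by (intro mh_sum_module_generator power_series_functions_const) auto
    then show ?thesis by (simp only: mh_sum_p_snoc True)
  next
    case False
    then show ?thesis
      using c mh_sum_module_generator[OF power_series_functions_const[of 0], of "[]"] by simp
  qed
  from mh_sum_module_add[OF this Suc.IH[OF h]] show ?case
    by (rule mh_sum_module_cong) (rule eq)
qed

text \<open>Induction on the depth of \<open>t\<close>. After the denominator is absorbed, summation by parts trades the summation of
  \<open>f\<close> against the last summation inside \<open>mh_sum_p\<close>; the residue class and the exponent change in this step,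
  and for this reason the claim is generalised over \<open>m\<close> and \<open>s\<close>.\<close>

lemma class_sum_generator_in_module:
  fixes f :: "nat \<Rightarrow> 'p::prime_card padic"
  assumes "f \<in> power_series_functions" "\<And>x. x \<in> set t \<Longrightarrow> 0 < x" "m < CARD('p)"
  shows "class_sum m (\<lambda>j. f j * mh_sum_p t j / of_nat j ^ s) \<in> mh_sum_module"
  using assms
proof (induction t arbitrary: f m s rule: rev_induct)
  case Nil
  show ?case
  proof (rule class_sum_divide_power_in_module[OF Nil(2,3) _ Nil(1)])
    fix f :: "nat \<Rightarrow> 'p padic" assume "f \<in> power_series_functions"
    then obtain H where H: "H \<in> power_series_functions"
      "\<And>n. H (Suc n) = H n + (if n mod CARD('p) = m then f n else 0)"
      using power_series_functions_antidifference[OF _ Nil(3)] by blast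
    have "class_sum m f n = H n + - H 1" if "n \<ge> 1" for n
      using that by (induction n rule: dec_induct) (simp_all add: class_sum_Suc H(2))
    moreover have "(\<lambda>n. (H n + - H 1) * mh_sum_p [] n) \<in> mh_sum_module"
      by (intro mh_sum_module_generator power_series_functions_add H power_series_functions_const) simp
    ultimately show "class_sum m (\<lambda>j. f j * mh_sum_p [] j) \<in> mh_sum_module"
      by (elim mh_sum_module_cong) (simp add: mh_sum_p_Nil)
  qed
next
  case (snoc a t)
  have pos: "0 < x" if "x \<in> set t" for x using snoc.prems(2) that by simp
  show ?case
  proof (rule class_sum_divide_power_in_module[OF snoc.prems(2,3) _ snoc.prems(1)])
    fix f :: "nat \<Rightarrow> 'p padic" assume f: "f \<in> power_series_functions"
    then obtain H where H: "H \<in> power_series_functions"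
      "\<And>n. H (Suc n) = H n + (if n mod CARD('p) = m then f n else 0)"
      using power_series_functions_antidifference[OF _ snoc.prems(3)] by blast
    let ?\<sigma> = "mh_sum_p (t @ [a]) :: nat \<Rightarrow> 'p padic"
    let ?R = "class_sum 0 (\<lambda>l. H (Suc l) * mh_sum_p t l / of_nat l ^ a)"
    \<comment> \<open>Both sides vanish at \<open>0\<close>, since \<open>?\<sigma>\<close> is an empty sum there, and have the same differences.\<close>
    have abel: "class_sum m (\<lambda>j. f j * ?\<sigma> j) n = H n * ?\<sigma> n + - 1 * ?R n" for n
    proof (induction n)
      case 0
      show ?case by (simp add: mh_sum_p_snoc)
    next
      case (Suc n)
      have \<sigma>: "?\<sigma> (Suc n) = ?\<sigma> n + (if 0 < n \<and> n mod CARD('p) = 0 then mh_sum_p t n / of_nat n ^ a else 0)"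
        by (simp add: mh_sum_p_snoc class_sum_Suc)
      have \<sigma>0: "?\<sigma> 0 = 0" by (simp add: mh_sum_p_snoc)
      show ?case
        unfolding class_sum_Suc Suc \<sigma> using \<sigma>0 by (cases "n = 0") (simp_all add: H(2) algebra_simps add_divide_distrib)
    qed
    have "overconvergent (\<lambda>x. f (m + CARD('p) * x))"
      using f snoc.prems(3) by (simp add: power_series_functions_iff)
    then have "(\<lambda>l. H (Suc l)) \<in> power_series_functions"
      unfolding H(2) by (intro power_series_functions_add H power_series_functions_restrict)
    then have "?R \<in> mh_sum_module" by (rule snoc.IH) (use pos in simp_all)
    then have "(\<lambda>n. H n * ?\<sigma> n + - 1 * ?R n) \<in> mh_sum_module"
      using snoc.prems(2) H(1) by (intro mh_sum_module_add mh_sum_module_cmult mh_sum_module_generator) auto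
    then show "class_sum m (\<lambda>j. f j * ?\<sigma> j) \<in> mh_sum_module"
      by (rule mh_sum_module_cong) (rule abel)
  qed
qed

lemma class_sum_module:
  fixes g :: "nat \<Rightarrow> 'p::prime_card padic"
  assumes "g \<in> mh_sum_module" "m < CARD('p)"
  shows "class_sum m (\<lambda>j. g j / of_nat j ^ s) \<in> mh_sum_module"
proof -
  obtain S f where S: "finite S" "\<And>t. t \<in> S \<Longrightarrow> (\<forall>x\<in>set t. 0 < x) \<and> f t \<in> power_series_functions"
    "\<And>n. n \<ge> 1 \<Longrightarrow> g n = (\<Sum>t\<in>S. f t n * mh_sum_p t n)"
    using assms(1) unfolding mh_sum_module_def by blast
  have eq: "class_sum m (\<lambda>j. g j / of_nat j ^ s) n
      = (\<Sum>t\<in>S. class_sum m (\<lambda>j. f t j * mh_sum_p t j / of_nat j ^ s) n)" for n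
  proof -
    have "class_sum m (\<lambda>j. g j / of_nat j ^ s) n
        = class_sum m (\<lambda>j. \<Sum>t\<in>S. f t j * mh_sum_p t j / of_nat j ^ s) n"
      by (rule class_sum_cong) (simp add: S(3) sum_divide_distrib)
    then show ?thesis by (simp add: class_sum_def sum.swap[of _ S])
  qed
  have "(\<lambda>n. \<Sum>t\<in>S. class_sum m (\<lambda>j. f t j * mh_sum_p t j / of_nat j ^ s) n) \<in> mh_sum_module"
    using S assms(2) by (intro mh_sum_module_sum class_sum_generator_in_module) auto
  then show ?thesis by (rule mh_sum_module_cong) (rule eq)
qed

lemma mh_sum_in_module:
  fixes s m :: "nat list"
  assumes "length m = length s" and "\<forall>x\<in>set m. x < CARD('p::prime_card)"
  shows "(mh_sum s m :: nat \<Rightarrow> 'p padic) \<in> mh_sum_module"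
  using assms
proof (induction s arbitrary: m rule: rev_induct)
  case Nil
  have "(\<lambda>n. 1 * mh_sum_p [] n :: 'p padic) \<in> mh_sum_module"
    by (rule mh_sum_module_generator[OF power_series_functions_const]) simp
  then show ?case using Nil by (simp add: mh_sum_p_def)
next
  case (snoc a s)
  then obtain m' b where m: "m = m' @ [b]" by (metis length_0_conv rev_exhaust snoc_eq_iff_butlast)
  with snoc have "mh_sum s m' \<in> (mh_sum_module :: (nat \<Rightarrow> 'p padic) set)" and "b < CARD('p)" by auto
  then have "class_sum b (\<lambda>j. mh_sum s m' j / of_nat j ^ a) \<in> (mh_sum_module :: (nat \<Rightarrow> 'p padic) set)"
    by (rule class_sum_module)
  then show ?case
    unfolding m by (rule mh_sum_module_cong) (use snoc.prems m in \<open>simp add: mh_sum_snoc\<close>)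
qed

theorem proposition2p0p7:
  fixes s m :: "nat list"
  assumes "length s \<ge> 1" and "length m = length s"
    and "\<forall>x\<in>set m. x < CARD('p::prime_card)"
  shows "(mh_sum s m :: nat \<Rightarrow> 'p padic) \<in> mh_sum_module"
  using assms(2,3) by (rule mh_sum_in_module)

end
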